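(* (a) For every $0\le r\le n$, every $x\in\mathrm{X}_r$ and every $y\in\mathrm{X}_r$ with $\partial(x,y)=1$, the number of $h\in\mathbf{T}$ with $hx=y$ equals $q^{n-2}(q-1)$; moreover $\mathcal{L}_{\mathbf{T},r}=q^{n-2}(q-1)\mathcal{L}_r$. (b) Every $\mathrm{G}$-equivariant $\Lambda:\mathrm{V}_{r_1}\to\mathrm{V}_{r_2}$ satisfies $\mathcal{L}_{r_2}\circ\Lambda=\mathcal{L}_{r_1,r_2}\Lambda=\Lambda\circ\mathcal{L}_{r_1}$. (c) For each $s$ there is a number $\mu_s(n)$ (depending only on $s$ and $n$) such that $\mathcal{L}_r\varphi+\mu_s(n)\varphi=0$ for every $r$ with $s\le\min(r,n-r)$ and every $\varphi\in\mathrm{V}_{r,s}$, and $\mathcal{L}_{r_1,r_2}\Lambda+\mu_s(n)\Lambda=0$ for every $\mathrm{G}$-equivariant $\Lambda:\mathrm{V}_{r_1,s}\to\mathrm{V}_{r_2,s}$ (regarded as a map $\mathrm{V}_{r_1}\to\mathrm{V}_{r_2}$ vanishing on the orthogonal complement of $\mathrm{V}_{r_1,s}$), $0\le s\le\mathrm{N}(r_1,r_2)$. (d) If the $\mathrm{G}$-equivariant $\Lambda:\mathrm{V}_{r_1}\to\mathrm{V}_{r_2}$ has kernel $\lambda$, then $\Lambda'=\mathcal{L}_{r_1,r_2}\Lambda$ has kernel $\lambda'(t)=\mathbf{b}_{r_1,r_2}(t)(\lambda(t+1)-\lambda(t))+\mathbf{c}_{r_1,r_2}(t)(\lambda(t-1)-\lambda(t))$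 for $t\in\mathrm{I}_n(r_1,r_2)$, where for any $(x_1,x_2)\in\mathrm{X}_{r_1}\times\mathrm{X}_{r_2}$ with $\partial(x_2,x_1)=t$, $\mathbf{b}_{r_1,r_2}(t)=|\{y\in\mathrm{X}_{r_2}:\partial(y,x_2)=1,\ \partial(y,x_1)=t+1\}|$ and $\mathbf{c}_{r_1,r_2}(t)=|\{y\in\mathrm{X}_{r_2}:\partial(y,x_2)=1,\ \partial(y,x_1)=t-1\}|$ (a term in which $\lambda$ is evaluated outside $\mathrm{I}_n(r_1,r_2)$ has zero coefficient). (e) $\mathbf{b}_{r_1,r_2}(t)=\dfrac{q^{r_1-r_2+1}(q^t-q^{r_2})(q^t-q^{n-r_1})}{(q-1)^2}$ and $\mathbf{c}_{r_1,r_2}(t)=\dfrac{q^{r_1-r_2}(q^t-1)(q^t-q^{r_2-r_1})}{(q-1)^2}$.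
   Context: Let $q$ be a prime power, $\Omega$ an $n$-dimensional vector space over $\mathbb{F}_q$, $\mathrm{G}=\mathrm{GL}(\Omega)$, $\mathrm{X}_r$ the set of $r$-dimensional subspaces, $\partial(x,y)=\dim(x/(x\cap y))$, $\mathrm{V}_r$ the space of functions $\mathrm{X}_r\to\mathbb{C}$ with $\mathrm{G}$ acting by $(\rho_r(g)\varphi)(x)=\varphi(g^{-1}x)$. $\mathrm{N}(r_1,r_2)=\min(r_1,r_2,n-r_1,n-r_2)$, $\mathrm{I}_n(r_1,r_2)=\{t\in\mathbb{Z}:\max(0,r_2-r_1)\le t\le\min(r_2,n-r_1)\}$. A $\mathrm{G}$-equivariant $\Lambda:\mathrm{V}_{r_1}\to\mathrm{V}_{r_2}$ has the form $\Lambda\varphi(x_2)=\sum_{x_1}\lambda(\partial(x_2,x_1))\varphi(x_1)$ with $\lambda:\mathrm{I}_n(r_1,r_2)\to\mathbb{C}$ its kernel. There are pairwise inequivalent irreducible representations $\pi_s$ of $\mathrm{G}$ and orthogonal decompositions into irreducible invariant subspaces $\mathrm{V}_r=\bigoplus_{s=0}^{\min(r,n-r)}\mathrm{V}_{r,s}$ with $\mathrm{V}_{r,s}\simeq\pi_s$. Graph Laplacian: $\mathcal{L}_r\varphi(x)=\sum_{y\in\mathrm{X}_r,\,\partial(x,y)=1}(\varphi(y)-\varphi(x))$; $\mathcal{L}_{r_1,r_2}\Lambda=\mathcal{L}_{r_2}\circ\Lambda$. Let $\mathbf{T}=\{g\in\mathrm{G}:\mathrm{rk}(g-1)=1,\ (g-1)^2=0\}$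 and the group Laplacian $\mathcal{L}_{\mathbf{T},r}\varphi(x)=\sum_{h\in\mathbf{T}}(\varphi(hx)-\varphi(x))$. *)

theory Defs
  imports Complex_Main "HOL-Library.Function_Algebras"
begin

text \<open>
  Throughout, \<open>scale\<close> is the scalar multiplication of a vector space \<open>\<Omega>\<close> over a finite field,
  the carrier of \<open>\<Omega>\<close> being the whole type \<open>'v\<close>.
\<close>

definition GL :: "('k::field \<Rightarrow> 'v::ab_group_add \<Rightarrow> 'v) \<Rightarrow> ('v \<Rightarrow> 'v) set" where
  "GL scale = {g. Vector_Spaces.linear scale scale g \<and> bij g}"

definition subspaces_dim :: "('k::field \<Rightarrow> 'v::ab_group_add \<Rightarrow> 'v) \<Rightarrow> nat \<Rightarrow> 'v set set" where
  "subspaces_dim scale r = {x. module.subspace scale x \<and> vector_space.dim scale x = r}"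

text \<open>The dimension of the quotient space \<open>x / (x \<inter> y)\<close>; see \<open>sdist_eq_dim_quotient\<close> below.\<close>

definition sdist :: "('k::field \<Rightarrow> 'v::ab_group_add \<Rightarrow> 'v) \<Rightarrow> 'v set \<Rightarrow> 'v set \<Rightarrow> nat" where
  "sdist scale x y = vector_space.dim scale x - vector_space.dim scale (x \<inter> y)"

text \<open>
  Every model of the quotient \<open>x / (x \<inter> y)\<close>, i.e. the image of \<open>x\<close> under a linear map with kernel
  \<open>x \<inter> y\<close> on \<open>x\<close>, has dimension \<open>sdist scale x y\<close>.
\<close>

lemma sdist_eq_dim_quotient:
  assumes "finite_dimensional_vector_space scale Basis"
    and lin: "Vector_Spaces.linear scale scale' f"
    and x: "module.subspace scale x"
    and ker: "{v \<in> x. f v = 0} = x \<inter> y"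
  shows "vector_space.dim scale' (f ` x) = sdist scale x y"
proof -
  interpret V: finite_dimensional_vector_space scale Basis by fact
  interpret lf: Vector_Spaces.linear scale scale' f by fact
  interpret pr: finite_dimensional_vector_space_pair_1 scale Basis scale' ..
  obtain B where B: "B \<subseteq> x \<inter> y" "\<not> V.dependent B" "x \<inter> y \<subseteq> V.span B" "card B = V.dim (x \<inter> y)"
    using V.basis_exists by blast
  obtain C where C: "B \<subseteq> C" "C \<subseteq> x" "\<not> V.dependent C" "x \<subseteq> V.span C"
    using V.maximal_independent_subset_extend[of B x] B by blast
  have fin: "finite C" using C(3) by (rule V.finiteI_independent)
  have xC: "x = V.span C" using C x by (simp add: V.span_minimal subset_antisym)
  have dimx: "V.dim x = card C" using xC C(3) by (simp add: V.dim_eq_card_independent)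
  have indD: "\<not> V.dependent (C - B)" using C(3) V.independent_mono by blast
  have disj: "V.span (C - B) \<inter> V.span B = {0}"
  proof -
    have "v = 0" if v1: "v \<in> V.span (C - B)" and v2: "v \<in> V.span B" for v
    proof -
      have r1: "V.representation C v = V.representation (C - B) v"
        using v1 C(3) by (intro V.representation_extend) auto
      have r2: "V.representation C v = V.representation B v"
        using v2 C(1,3) by (intro V.representation_extend) auto
      have "V.representation C v b = 0" for b
        using V.representation_ne_zero[of "C - B" v b] V.representation_ne_zero[of B v b] r1 r2 by auto
      moreover have "v \<in> V.span C" using xC C(1) v2 V.span_mono by blast
      ultimately show ?thesis
        using V.sum_nonzero_representation_eq[of C v] C(3) by simp
    qed
    then show ?thesis using V.span_zero by blast
  qed
  have sub: "V.span (C - B) \<subseteq> x" using xC V.span_mono[of "C - B" C] by auto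
  have inj: "inj_on f (V.span (C - B))"
  proof (rule inj_onI)
    fix u v assume u: "u \<in> V.span (C - B)" and v: "v \<in> V.span (C - B)" and "f u = f v"
    then have "f (u - v) = 0" by (simp add: lf.diff)
    moreover have d: "u - v \<in> V.span (C - B)" using u v by (rule V.span_diff)
    ultimately have "u - v \<in> x \<inter> y" using sub ker by blast
    then have "u - v \<in> V.span B" using B by blast
    then have "u - v = 0" using d disj by blast
    then show "u = v" by simp
  qed
  have f0: "f b = 0" if "b \<in> B" for b using that B(1) ker by blast
  have "f ` C \<subseteq> lf.vs2.span (f ` (C - B))"
    using f0 lf.vs2.span_base lf.vs2.span_zero by (metis (full_types) DiffI image_eqI image_subsetI)
  then have "lf.vs2.span (f ` C) = lf.vs2.span (f ` (C - B))"
    by (metis Diff_subset image_mono lf.vs2.span_mono lf.vs2.span_minimal lf.vs2.subspace_span subset_antisym)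
  then have "f ` x = lf.vs2.span (f ` (C - B))" using xC lf.span_image by simp
  then have "lf.vs2.dim (f ` x) = lf.vs2.dim (f ` (C - B))" by simp
  also have "\<dots> = V.dim (C - B)" using pr.dim_image_eq[OF lin inj] .
  also have "\<dots> = card C - card B"
    using indD fin C(1) by (simp add: V.dim_eq_card_independent card_Diff_subset finite_subset)
  finally show ?thesis using dimx B(4) by (simp add: sdist_def)
qed

definition transvections :: "('k::field \<Rightarrow> 'v::ab_group_add \<Rightarrow> 'v) \<Rightarrow> ('v \<Rightarrow> 'v) set" where
  "transvections scale =
     {g \<in> GL scale. vector_space.dim scale (range (\<lambda>v. g v - v)) = 1 \<and>
                    (\<lambda>v. g v - v) \<circ> (\<lambda>v. g v - v) = (\<lambda>v. 0)}"

text \<open>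
  A function on \<open>X\<^sub>r\<close> is represented by its extension by zero to all of \<open>'v set\<close>.
\<close>

definition fspace :: "('k::field \<Rightarrow> 'v::ab_group_add \<Rightarrow> 'v) \<Rightarrow> nat \<Rightarrow> ('v set \<Rightarrow> complex) set" where
  "fspace scale r = {\<phi>. \<forall>x. x \<notin> subspaces_dim scale r \<longrightarrow> \<phi> x = 0}"

definition fscale :: "complex \<Rightarrow> ('a \<Rightarrow> complex) \<Rightarrow> 'a \<Rightarrow> complex" where
  "fscale c \<phi> = (\<lambda>x. c * \<phi> x)"

definition finner ::
  "('k::field \<Rightarrow> 'v::ab_group_add \<Rightarrow> 'v) \<Rightarrow> nat \<Rightarrow> ('v set \<Rightarrow> complex) \<Rightarrow> ('v set \<Rightarrow> complex) \<Rightarrow> complex" where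
  "finner scale r \<phi> \<psi> = (\<Sum>x\<in>subspaces_dim scale r. \<phi> x * cnj (\<psi> x))"

text \<open>The same formula describes the action of the group on every \<open>V\<^sub>r\<close>.\<close>

definition rho :: "('v \<Rightarrow> 'v) \<Rightarrow> ('v set \<Rightarrow> complex) \<Rightarrow> 'v set \<Rightarrow> complex" where
  "rho g \<phi> = (\<lambda>x. \<phi> (inv g ` x))"

definition linear_between ::
  "(complex \<Rightarrow> 'a::ab_group_add \<Rightarrow> 'a) \<Rightarrow> 'a set \<Rightarrow>
   (complex \<Rightarrow> 'b::ab_group_add \<Rightarrow> 'b) \<Rightarrow> 'b set \<Rightarrow> ('a \<Rightarrow> 'b) \<Rightarrow> bool" where
  "linear_between s1 W1 s2 W2 f \<longleftrightarrow>
     (\<forall>v\<in>W1. f v \<in> W2) \<and>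
     (\<forall>v\<in>W1. \<forall>w\<in>W1. f (v + w) = f v + f w) \<and>
     (\<forall>c. \<forall>v\<in>W1. f (s1 c v) = s2 c (f v))"

text \<open>
  A complex representation of \<open>GL scale\<close> consists of a subspace \<open>W\<close> of a complex vector space
  with scalar multiplication \<open>s\<close>, and an action \<open>p\<close> on \<open>W\<close>.
\<close>

definition is_rep ::
  "('k::field \<Rightarrow> 'v::ab_group_add \<Rightarrow> 'v) \<Rightarrow>
   (complex \<Rightarrow> 'a::ab_group_add \<Rightarrow> 'a) \<Rightarrow> 'a set \<Rightarrow> (('v \<Rightarrow> 'v) \<Rightarrow> 'a \<Rightarrow> 'a) \<Rightarrow> bool" where
  "is_rep scale s W p \<longleftrightarrow>
     vector_space s \<and> module.subspace s W \<and>
     (\<forall>g\<in>GL scale. linear_between s W s W (p g)) \<and>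
     (\<forall>w\<in>W. p id w = w) \<and>
     (\<forall>g\<in>GL scale. \<forall>h\<in>GL scale. \<forall>w\<in>W. p (g \<circ> h) w = p g (p h w))"

definition irreducible_rep ::
  "('k::field \<Rightarrow> 'v::ab_group_add \<Rightarrow> 'v) \<Rightarrow>
   (complex \<Rightarrow> 'a::ab_group_add \<Rightarrow> 'a) \<Rightarrow> 'a set \<Rightarrow> (('v \<Rightarrow> 'v) \<Rightarrow> 'a \<Rightarrow> 'a) \<Rightarrow> bool" where
  "irreducible_rep scale s W p \<longleftrightarrow>
     is_rep scale s W p \<and> W \<noteq> {0} \<and>
     (\<forall>U. module.subspace s U \<and> U \<subseteq> W \<and> (\<forall>g\<in>GL scale. \<forall>u\<in>U. p g u \<in> U)
          \<longrightarrow> U = {0} \<or> U = W)"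

definition equivariant_between ::
  "('k::field \<Rightarrow> 'v::ab_group_add \<Rightarrow> 'v) \<Rightarrow>
   (complex \<Rightarrow> 'a::ab_group_add \<Rightarrow> 'a) \<Rightarrow> 'a set \<Rightarrow> (('v \<Rightarrow> 'v) \<Rightarrow> 'a \<Rightarrow> 'a) \<Rightarrow>
   (complex \<Rightarrow> 'b::ab_group_add \<Rightarrow> 'b) \<Rightarrow> 'b set \<Rightarrow> (('v \<Rightarrow> 'v) \<Rightarrow> 'b \<Rightarrow> 'b) \<Rightarrow>
   ('a \<Rightarrow> 'b) \<Rightarrow> bool" where
  "equivariant_between scale s1 W1 p1 s2 W2 p2 f \<longleftrightarrow>
     linear_between s1 W1 s2 W2 f \<and>
     (\<forall>g\<in>GL scale. \<forall>w\<in>W1. f (p1 g w) = p2 g (f w))"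

definition equivalent_reps ::
  "('k::field \<Rightarrow> 'v::ab_group_add \<Rightarrow> 'v) \<Rightarrow>
   (complex \<Rightarrow> 'a::ab_group_add \<Rightarrow> 'a) \<Rightarrow> 'a set \<Rightarrow> (('v \<Rightarrow> 'v) \<Rightarrow> 'a \<Rightarrow> 'a) \<Rightarrow>
   (complex \<Rightarrow> 'b::ab_group_add \<Rightarrow> 'b) \<Rightarrow> 'b set \<Rightarrow> (('v \<Rightarrow> 'v) \<Rightarrow> 'b \<Rightarrow> 'b) \<Rightarrow> bool" where
  "equivalent_reps scale s1 W1 p1 s2 W2 p2 \<longleftrightarrow>
     (\<exists>f. equivariant_between scale s1 W1 p1 s2 W2 p2 f \<and> bij_betw f W1 W2)"

abbreviation equivariant ::
  "('k::field \<Rightarrow> 'v::ab_group_add \<Rightarrow> 'v) \<Rightarrow> ('v set \<Rightarrow> complex) set \<Rightarrow> ('v set \<Rightarrow> complex) set \<Rightarrow>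
   (('v set \<Rightarrow> complex) \<Rightarrow> 'v set \<Rightarrow> complex) \<Rightarrow> bool" where
  "equivariant scale W1 W2 \<Lambda> \<equiv> equivariant_between scale fscale W1 rho fscale W2 rho \<Lambda>"

text \<open>
  The representations \<open>\<pi>\<^sub>s\<close>, given by the action \<open>p s\<close> on \<open>W s\<close>, and the decompositions
  of the spaces \<open>V\<^sub>r\<close> into the \<open>Vs r s\<close>.  The index \<open>s\<close> occurs in some \<open>V\<^sub>r\<close>
  iff \<open>s \<le> n div 2\<close>.  The last but one conjunct says that \<open>V\<^sub>r\<close> is the sum of the
  \<open>Vs r s\<close>; the sum is direct by orthogonality.
\<close>

definition irreducible_decomposition ::
  "('k::field \<Rightarrow> 'v::ab_group_add \<Rightarrow> 'v) \<Rightarrow> nat \<Rightarrow>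
   (complex \<Rightarrow> 'a::ab_group_add \<Rightarrow> 'a) \<Rightarrow> (nat \<Rightarrow> 'a set) \<Rightarrow> (nat \<Rightarrow> ('v \<Rightarrow> 'v) \<Rightarrow> 'a \<Rightarrow> 'a) \<Rightarrow>
   (nat \<Rightarrow> nat \<Rightarrow> ('v set \<Rightarrow> complex) set) \<Rightarrow> bool" where
  "irreducible_decomposition scale n sc W p Vs \<longleftrightarrow>
     (\<forall>s\<le>n div 2. irreducible_rep scale sc (W s) (p s)) \<and>
     (\<forall>s\<le>n div 2. \<forall>s'\<le>n div 2. s \<noteq> s' \<longrightarrow>
        \<not> equivalent_reps scale sc (W s) (p s) sc (W s') (p s')) \<and>
     (\<forall>r\<le>n. \<forall>s\<le>min r (n - r).
        Vs r s \<subseteq> fspace scale r \<and> irreducible_rep scale fscale (Vs r s) rho \<and>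
        equivalent_reps scale fscale (Vs r s) rho sc (W s) (p s)) \<and>
     (\<forall>r\<le>n. fspace scale r =
        {\<Sum>s\<le>min r (n - r). f s | f. \<forall>s\<le>min r (n - r). f s \<in> Vs r s}) \<and>
     (\<forall>r\<le>n. \<forall>s\<le>min r (n - r). \<forall>s'\<le>min r (n - r). s \<noteq> s' \<longrightarrow>
        (\<forall>\<phi>\<in>Vs r s. \<forall>\<psi>\<in>Vs r s'. finner scale r \<phi> \<psi> = 0))"

definition graph_laplacian ::
  "('k::field \<Rightarrow> 'v::ab_group_add \<Rightarrow> 'v) \<Rightarrow> nat \<Rightarrow> ('v set \<Rightarrow> complex) \<Rightarrow> 'v set \<Rightarrow> complex" where
  "graph_laplacian scale r \<phi> = (\<lambda>x.
     if x \<in> subspaces_dim scale r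
     then \<Sum>y\<in>{y \<in> subspaces_dim scale r. sdist scale x y = 1}. \<phi> y - \<phi> x
     else 0)"

definition group_laplacian ::
  "('k::field \<Rightarrow> 'v::ab_group_add \<Rightarrow> 'v) \<Rightarrow> nat \<Rightarrow> ('v set \<Rightarrow> complex) \<Rightarrow> 'v set \<Rightarrow> complex" where
  "group_laplacian scale r \<phi> = (\<lambda>x.
     if x \<in> subspaces_dim scale r
     then \<Sum>h\<in>transvections scale. \<phi> (h ` x) - \<phi> x
     else 0)"

definition op_laplacian ::
  "('k::field \<Rightarrow> 'v::ab_group_add \<Rightarrow> 'v) \<Rightarrow> nat \<Rightarrow> nat \<Rightarrow>
   (('v set \<Rightarrow> complex) \<Rightarrow> 'v set \<Rightarrow> complex) \<Rightarrow> ('v set \<Rightarrow> complex) \<Rightarrow> 'v set \<Rightarrow> complex" where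
  "op_laplacian scale r1 r2 \<Lambda> = graph_laplacian scale r2 \<circ> \<Lambda>"

definition I_set :: "nat \<Rightarrow> nat \<Rightarrow> nat \<Rightarrow> int set" where
  "I_set n r1 r2 = {t. max 0 (int r2 - int r1) \<le> t \<and> t \<le> min (int r2) (int n - int r1)}"

definition N_min :: "nat \<Rightarrow> nat \<Rightarrow> nat \<Rightarrow> nat" where
  "N_min n r1 r2 = min (min r1 r2) (min (n - r1) (n - r2))"

text \<open>
  Only the values of the kernel \<open>k\<close> on \<open>I_set n r1 r2\<close> matter here, as \<open>sdist scale x2 x1\<close>
  always lies in that set.
\<close>

definition has_kernel ::
  "('k::field \<Rightarrow> 'v::ab_group_add \<Rightarrow> 'v) \<Rightarrow> nat \<Rightarrow> nat \<Rightarrow>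
   (('v set \<Rightarrow> complex) \<Rightarrow> 'v set \<Rightarrow> complex) \<Rightarrow> (int \<Rightarrow> complex) \<Rightarrow> bool" where
  "has_kernel scale r1 r2 \<Lambda> k \<longleftrightarrow>
     (\<forall>\<phi>\<in>fspace scale r1. \<forall>x2\<in>subspaces_dim scale r2.
        \<Lambda> \<phi> x2 = (\<Sum>x1\<in>subspaces_dim scale r1. k (int (sdist scale x2 x1)) * \<phi> x1))"

definition neighbours_at ::
  "('k::field \<Rightarrow> 'v::ab_group_add \<Rightarrow> 'v) \<Rightarrow> nat \<Rightarrow> 'v set \<Rightarrow> 'v set \<Rightarrow> int \<Rightarrow> 'v set set" where
  "neighbours_at scale r2 x1 x2 u =
     {y \<in> subspaces_dim scale r2. sdist scale y x2 = 1 \<and> int (sdist scale y x1) = u}"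

text \<open>
  The common value of the respective cardinality over all pairs \<open>(x1, x2)\<close> at distance \<open>t\<close>;
  that the cardinality does not depend on the pair has to be proved.
\<close>

definition b_coeff ::
  "('k::field \<Rightarrow> 'v::ab_group_add \<Rightarrow> 'v) \<Rightarrow> nat \<Rightarrow> nat \<Rightarrow> int \<Rightarrow> nat" where
  "b_coeff scale r1 r2 t = (THE k. \<forall>x1\<in>subspaces_dim scale r1. \<forall>x2\<in>subspaces_dim scale r2.
     int (sdist scale x2 x1) = t \<longrightarrow> card (neighbours_at scale r2 x1 x2 (t + 1)) = k)"

definition c_coeff ::
  "('k::field \<Rightarrow> 'v::ab_group_add \<Rightarrow> 'v) \<Rightarrow> nat \<Rightarrow> nat \<Rightarrow> int \<Rightarrow> nat" where
  "c_coeff scale r1 r2 t = (THE k. \<forall>x1\<in>subspaces_dim scale r1. \<forall>x2\<in>subspaces_dim scale r2.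
     int (sdist scale x2 x1) = t \<longrightarrow> card (neighbours_at scale r2 x1 x2 (t - 1)) = k)"

end

theory Submission
  imports Defs "HOL-Library.FuncSet" "HOL-Computational_Algebra.Fundamental_Theorem_Algebra"
begin

text \<open>
  All counts are made with linear functionals: a subspace \<open>y\<close> adjacent to \<open>x\<close> arises from a functional
  \<open>f\<close> cutting out a hyperplane \<open>z\<close> of \<open>x\<close> and a vector \<open>v\<close> outside \<open>x\<close>, as \<open>y = z + \<langle>v\<rangle>\<close>, and the number of
  pairs \<open>(f, v)\<close> giving the same \<open>y\<close> depends only on the dimensions.  Whether \<open>y\<close> is farther from or
  closer to \<open>x\<^sub>1\<close> than \<open>x\<close> is decided by whether \<open>f\<close> vanishes on \<open>x \<inter> x\<^sub>1\<close> and whether \<open>v \<in> z + x\<^sub>1\<close>;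
  this gives \<open>\<^bold>b\<close> and \<open>\<^bold>c\<close>.  A transvection \<open>w \<mapsto> w + f(w)u\<close> moving \<open>x\<close> to a neighbour \<open>y\<close> is normalized
  by \<open>f(u\<^sub>0) = 1\<close> for a fixed \<open>u\<^sub>0 \<in> x - y\<close> and then counted as a pair \<open>(u\<^sub>0 + u, f)\<close>.

  Since the graph Laplacian is thus a multiple of the action of an element of the group algebra, it
  commutes with all intertwiners; on an irreducible subspace it is a scalar by Schur's lemma, and the
  scalar can be read off in the equivalent representation \<open>\<pi>\<^sub>s\<close>, hence does not depend on \<open>r\<close>.
\<close>

subsection \<open>Intertwiners and eigenvectors in function spaces\<close>

lemma vector_space_fscale: "vector_space fscale"
  by unfold_locales (auto simp: fscale_def fun_eq_iff algebra_simps)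

lemma sum_fun_apply: "(\<Sum>i\<in>I. f i) x = (\<Sum>i\<in>I. f i x)" for f :: "'i \<Rightarrow> 'b \<Rightarrow> complex"
  by (induction I rule: infinite_finite_induct) simp_all

text \<open>The usual proof by polynomials: enough iterates \<open>(L ^^ i) \<phi>\<close> are
  dependent, so some nonzero \<open>p\<close> has \<open>p(L) \<phi> = 0\<close>, and splitting off
  roots of \<open>p\<close> one at a time must pass through an eigenvector.\<close>

lemma eigenvector_exists:
  fixes L :: "('b \<Rightarrow> complex) \<Rightarrow> 'b \<Rightarrow> complex"
  assumes fin: "finite (UNIV :: 'b set)"
    and add: "\<And>\<phi> \<psi>. L (\<phi> + \<psi>) = L \<phi> + L \<psi>" and scale: "\<And>c \<phi>. L (fscale c \<phi>) = fscale c (L \<phi>)"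
    and U: "module.subspace fscale U" and inv: "\<And>\<phi>. \<phi> \<in> U \<Longrightarrow> L \<phi> \<in> U"
    and \<phi>: "\<phi> \<in> U" "\<phi> \<noteq> 0"
  obtains a \<psi> where "\<psi> \<in> U" "\<psi> \<noteq> 0" "L \<psi> = fscale a \<psi>"
proof -
  interpret F: vector_space "fscale :: complex \<Rightarrow> ('b \<Rightarrow> complex) \<Rightarrow> _" by (rule vector_space_fscale)
  have L0: "L 0 = 0" using add[of 0 0] by simp
  \<comment> \<open>\<open>ev p\<close> is \<open>p(L) \<phi>\<close>, evaluated by Horner's
    rule.\<close>
  define ev where "ev p = fold_coeffs (\<lambda>a \<chi>. fscale a \<phi> + L \<chi>) p 0" for p :: "complex poly"
  have ev_0: "ev 0 = 0" by (simp add: ev_def)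
  have ev_pCons: "ev (pCons a p) = fscale a \<phi> + L (ev p)" for a p
    by (cases "a = 0 \<and> p = 0") (auto simp: ev_def L0)
  have ev_add: "ev (p + r) = ev p + ev r" for p r
  proof (induction p r rule: poly_induct2)
    case (pCons a p b r)
    then show ?case by (simp only: add_pCons ev_pCons add F.scale_left_distrib ac_simps)
  qed (simp add: ev_0)
  have ev_smult: "ev (smult c p) = fscale c (ev p)" for c p
  proof (induction p)
    case 0
    show ?case by (simp only: smult_0_right ev_0 F.scale_zero_right)
  next
    case (pCons a p)
    then show ?case by (simp only: smult_pCons ev_pCons scale F.scale_right_distrib F.scale_scale)
  qed
  have ev_monom: "ev (monom c i) = fscale c ((L ^^ i) \<phi>)" for c i
  proof (induction i)
    case 0
    show ?case by (simp only: monom_0 ev_pCons ev_0 L0 add_0_right funpow_0)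
  next
    case (Suc i)
    then show ?case by (simp only: monom_Suc ev_pCons scale F.scale_zero_left add_0_left funpow.simps o_apply)
  qed
  have ev_sum: "finite I \<Longrightarrow> ev (\<Sum>i\<in>I. P i) = (\<Sum>i\<in>I. ev (P i))" for I :: "nat set" and P
    by (induction I rule: finite_induct) (simp_all only: sum.empty sum.insert ev_0 ev_add not_False_eq_True)
  have ev_root: "ev ([:- a, 1:] * r) = L (ev r) - fscale a (ev r)" for a r
    by (simp only: mult_pCons_left mult_zero_left ev_add ev_smult ev_pCons pCons_0_0 add_0_right smult_1_left
        F.scale_zero_left F.scale_one F.scale_minus_left) simp
  have ev_U: "ev p \<in> U" for p
    by (induction p) (simp_all only: ev_0 ev_pCons F.subspace_add[OF U] F.subspace_scale[OF U] F.subspace_0[OF U] \<phi> inv)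
  have "\<exists>p. p \<noteq> 0 \<and> ev p = 0"
  proof -
    \<comment> \<open>The point indicators span the function space, so no independent set exceeds
      \<open>card E\<close>; the family \<open>?v\<close> below has one index more.\<close>
    define E where "E = range (\<lambda>(x :: 'b) y. if y = x then 1 else 0 :: complex)"
    have finE: "finite E" unfolding E_def using fin by simp
    have "\<chi> \<in> F.span E" for \<chi>
    proof -
      have "\<chi> = (\<Sum>x\<in>UNIV. fscale (\<chi> x) (\<lambda>y. if y = x then 1 else 0))"
      proof
        fix y
        show "\<chi> y = (\<Sum>x\<in>UNIV. fscale (\<chi> x) (\<lambda>y. if y = x then 1 else 0)) y"
          using fin by (simp add: fscale_def sum_fun_apply if_distrib[of "(*) _"] cong: if_cong)
      qed
      also have "\<dots> \<in> F.span E" by (intro F.span_sum F.span_scale F.span_base) (auto simp: E_def)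
      finally show ?thesis .
    qed
    then have bound: "card S \<le> card E" if "F.independent S" for S
      using F.independent_span_bound[OF finE that] by blast
    let ?I = "{..card E}" and ?v = "\<lambda>i. (L ^^ i) \<phi>"
    show ?thesis
    \<comment> \<open>A repetition among the iterates gives \<open>X^i - X^j\<close>. It is treated
      apart because dependence is a property of the set of vectors and does not see
      repetitions.\<close>
    proof (cases "inj_on ?v ?I")
      case False
      then obtain i j where ij: "i \<noteq> j" "?v i = ?v j" by (auto simp: inj_on_def)
      have "ev (monom 1 i + monom (- 1) j) = 0" using ij(2) by (simp add: ev_add ev_monom fscale_def fun_eq_iff)
      moreover have "coeff (monom 1 i + monom (- 1) j :: complex poly) i = 1" using ij(1) by simp
      then have "monom 1 i + monom (- 1) j \<noteq> (0 :: complex poly)" by (metis coeff_0 zero_neq_one)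
      ultimately show ?thesis by blast
    next
      case True
      have "F.dependent (?v ` ?I)" using bound[of "?v ` ?I"] card_image[OF True] by fastforce
      then obtain u where u: "\<exists>w\<in>?v ` ?I. u w \<noteq> 0" "(\<Sum>w\<in>?v ` ?I. fscale (u w) w) = 0"
        using F.dependent_finite[of "?v ` ?I"] by auto
      then obtain i where i: "i \<in> ?I" "u (?v i) \<noteq> 0" by blast
      let ?p = "\<Sum>i\<in>?I. monom (u (?v i)) i"
      have "ev ?p = 0" using u(2) by (simp add: ev_sum ev_monom sum.reindex[OF True])
      moreover have "coeff ?p i = u (?v i)" using i(1) by (simp add: coeff_sum sum.delta if_distrib cong: if_cong)
      then have "?p \<noteq> 0" using i(2) by (metis coeff_0)
      ultimately show ?thesis by blast
    qed
  qed
  then obtain p where "p \<noteq> 0" "ev p = 0" by blast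
  \<comment> \<open>Write \<open>p = (X - a) r\<close>: either \<open>ev r = 0\<close> and the
    degree drops, or \<open>ev r\<close> is an eigenvector for \<open>a\<close>.\<close>
  then have "\<exists>a \<psi>. \<psi> \<in> U \<and> \<psi> \<noteq> 0 \<and> L \<psi> = fscale a \<psi>"
  proof (induction "degree p" arbitrary: p rule: less_induct)
    case less
    have "degree p \<noteq> 0"
    proof
      assume "degree p = 0"
      then obtain c where "p = [:c:]" using degree_eq_zeroE by blast
      then show False using less.prems \<phi>(2) by (simp add: ev_pCons ev_0 L0)
    qed
    then have "\<not> constant (poly p)" by (simp add: constant_degree)
    then obtain a where "poly p a = 0" using fundamental_theorem_of_algebra by blast
    then obtain r where r: "p = [:- a, 1:] * r" by (auto simp: poly_eq_0_iff_dvd)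
    then have "r \<noteq> 0" using less.prems by auto
    then have deg: "degree r < degree p" unfolding r by (subst degree_mult_eq) auto
    show ?case
    proof (cases "ev r = 0")
      case True
      then show ?thesis using less.hyps[OF deg] \<open>r \<noteq> 0\<close> by blast
    next
      case False
      have "L (ev r) = fscale a (ev r)" using less.prems(2) ev_root[of a r] r by simp
      then show ?thesis using False ev_U by blast
    qed
  qed
  then show thesis using that by blast
qed

lemma linear_between_0:
  assumes "vector_space s1" "vector_space s2" "module.subspace s1 W1" "linear_between s1 W1 s2 W2 f"
  shows "f 0 = 0"
proof -
  interpret V1: vector_space s1 by fact
  interpret V2: vector_space s2 by fact
  have "f (s1 0 0) = s2 0 (f 0)"
    using assms(3,4) V1.subspace_0 unfolding linear_between_def by blast
  then show ?thesis by simp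
qed

lemma linear_between_sum:
  assumes vs: "vector_space s1" "vector_space s2" and W1: "module.subspace s1 W1"
    and f: "linear_between s1 W1 s2 W2 f" and v: "\<And>i. i \<in> I \<Longrightarrow> v i \<in> W1"
  shows "f (\<Sum>i\<in>I. v i) = (\<Sum>i\<in>I. f (v i))"
proof -
  interpret V1: vector_space s1 by fact
  show ?thesis
  proof (cases "finite I")
    case True
    then show ?thesis using v
    proof (induction I rule: finite_induct)
      case empty
      then show ?case using linear_between_0[OF vs W1 f] by simp
    next
      case (insert i I)
      have "(\<Sum>i\<in>I. v i) \<in> W1" using insert.prems by (intro V1.subspace_sum[OF W1]) auto
      then show ?case using insert f by (simp add: linear_between_def)
    qed
  qed (simp add: linear_between_0[OF vs W1 f])
qed

subsection \<open>Counting subspaces and functionals over a finite field\<close>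

locale finite_field_space = finite_dimensional_vector_space scale Basis
  for scale :: "'k::{field, finite} \<Rightarrow> 'v::ab_group_add \<Rightarrow> 'v" and Basis +
  fixes q n :: nat
  assumes card_field: "card (UNIV :: 'k set) = q" and dim_space: "dim UNIV = n"
begin

abbreviation X :: "nat \<Rightarrow> 'v set set" where "X \<equiv> subspaces_dim scale"
abbreviation functional :: "('v \<Rightarrow> 'k) \<Rightarrow> bool" where "functional \<equiv> Vector_Spaces.linear scale (*)"

text \<open>Defined for arbitrary sets, so that \<open>annihilator {}\<close> can stand for the
  whole dual space.\<close>

definition annihilator :: "'v set \<Rightarrow> ('v \<Rightarrow> 'k) set" where
  "annihilator z = {f. functional f \<and> (\<forall>w\<in>z. f w = 0)}"

lemma q_ge_2: "q \<ge> 2"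
proof -
  have "card {0, 1 :: 'k} \<le> q" unfolding card_field[symmetric] by (intro card_mono) auto
  then show ?thesis by simp
qed

lemma dual_pair: "vector_space_pair scale ((*) :: 'k \<Rightarrow> 'k \<Rightarrow> 'k)"
  by unfold_locales (simp_all add: algebra_simps)

text \<open>Coordinates with respect to a basis match \<open>z\<close> with the functions from the
  basis to the field.\<close>

lemma card_subspace:
  assumes "subspace z"
  shows "card z = q ^ dim z"
proof -
  obtain B where B: "B \<subseteq> z" "independent B" "z \<subseteq> span B" "card B = dim z"
    using basis_exists by blast
  have fin: "finite B" using B(2) by (rule finiteI_independent)
  have z: "z = span B" using B assms by (simp add: span_minimal subset_antisym)
  \<comment> \<open>Coordinate families are taken from \<open>PiE\<close>, hence fixed outside
    \<open>B\<close>; otherwise they would not be unique.\<close>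
  have "bij_betw (\<lambda>u. \<Sum>b\<in>B. scale (u b) b) (PiE B (\<lambda>_. UNIV)) z"
  proof (rule bij_betw_imageI)
    show "inj_on (\<lambda>u. \<Sum>b\<in>B. scale (u b) b) (PiE B (\<lambda>_. UNIV))"
    proof (rule inj_onI)
      fix u w assume u: "u \<in> PiE B (\<lambda>_. UNIV)" and w: "w \<in> PiE B (\<lambda>_. UNIV)"
        and "(\<Sum>b\<in>B. scale (u b) b) = (\<Sum>b\<in>B. scale (w b) b)"
      then have "(\<Sum>b\<in>B. scale (u b - w b) b) = 0"
        by (simp add: scale_left_diff_distrib sum_subtractf)
      then have "u b - w b = 0" if "b \<in> B" for b
        using B(2) fin that independent_explicit_finite_subsets[of B] by (metis subset_refl)
      then show "u = w" using u w by (intro PiE_ext) auto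
    qed
    have "\<exists>u'\<in>PiE B (\<lambda>_. UNIV). (\<Sum>b\<in>B. scale (u b) b) = (\<Sum>b\<in>B. scale (u' b) b)" for u
      by (intro bexI[of _ "restrict u B"] sum.cong) auto
    then show "(\<lambda>u. \<Sum>b\<in>B. scale (u b) b) ` (PiE B (\<lambda>_. UNIV)) = z"
      unfolding z span_finite[OF fin] by (auto simp: image_iff)
  qed
  then have "card z = card (PiE B (\<lambda>_. UNIV :: 'k set))" by (simp add: bij_betw_same_card)
  then show ?thesis using fin B(4) by (simp add: card_PiE card_field)
qed

text \<open>An infinite set would have cardinality 0, but \<open>card_subspace\<close> gives a
  positive power of \<open>q\<close>.\<close>

lemma finite_UNIV_space: "finite (UNIV :: 'v set)"
  using card_subspace[OF subspace_UNIV] q_ge_2 card_gt_0_iff by (metis nat_zero_less_power_iff pos2 order_less_le_trans)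

lemma finite_sets [simp]:
  "finite (A :: 'v set)" "finite (S :: 'v set set)" "finite (F :: ('v \<Rightarrow> 'v) set)" "finite (H :: ('v \<Rightarrow> 'k) set)"
proof -
  note fin = finite_UNIV_space
  show "finite A" using fin by (rule rev_finite_subset) simp
  have "finite (UNIV :: 'v set set)" using fin by (simp add: Finite_Set.finite_set)
  then show "finite S" by (rule rev_finite_subset) simp
  have "finite (PiE (UNIV :: 'v set) (\<lambda>_. UNIV :: 'v set))" using fin by (intro finite_PiE)
  then have "finite (UNIV :: ('v \<Rightarrow> 'v) set)" by (simp add: PiE_UNIV_domain)
  then show "finite F" by (rule rev_finite_subset) simp
  have "finite (PiE (UNIV :: 'v set) (\<lambda>_. UNIV :: 'k set))" using fin by (intro finite_PiE) auto
  then have "finite (UNIV :: ('v \<Rightarrow> 'k) set)" by (simp add: PiE_UNIV_domain)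
  then show "finite H" by (rule rev_finite_subset) simp
qed

text \<open>After extending \<open>B\<close> to a basis, the values on the \<open>n - card B\<close>
  added vectors are free and determine the functional.\<close>

lemma card_functionals_prescribed:
  assumes B: "independent B"
  shows "card {f. functional f \<and> (\<forall>b\<in>B. f b = g b)} = q ^ (n - card B)"
proof -
  interpret dual: vector_space_pair scale "(*) :: 'k \<Rightarrow> 'k \<Rightarrow> 'k" by (rule dual_pair)
  obtain C where C: "B \<subseteq> C" "independent C" "UNIV \<subseteq> span C"
    using maximal_independent_subset_extend[of B UNIV] B by auto
  have cC: "card C = n" using C dim_space by (metis basis_card_eq_dim subset_UNIV)
  have "bij_betw (\<lambda>f. restrict f (C - B)) {f. functional f \<and> (\<forall>b\<in>B. f b = g b)} (PiE (C - B) (\<lambda>_. UNIV))"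
  proof (rule bij_betw_imageI)
    show "inj_on (\<lambda>f. restrict f (C - B)) {f. functional f \<and> (\<forall>b\<in>B. f b = g b)}"
    proof (rule inj_onI)
      fix f h assume f: "f \<in> {f. functional f \<and> (\<forall>b\<in>B. f b = g b)}"
        and h: "h \<in> {f. functional f \<and> (\<forall>b\<in>B. f b = g b)}"
        and eq: "restrict f (C - B) = restrict h (C - B)"
      have "f b = h b" if "b \<in> C" for b
        using f h fun_cong[OF eq, of b] that by (cases "b \<in> B") auto
      then show "f = h" using dual.linear_eq_on[of f h _ C] f h C(3) by blast
    qed
    show "(\<lambda>f. restrict f (C - B)) ` {f. functional f \<and> (\<forall>b\<in>B. f b = g b)} = PiE (C - B) (\<lambda>_. UNIV)"
    proof (intro equalityI subsetI)
      fix u :: "'v \<Rightarrow> 'k" assume u: "u \<in> PiE (C - B) (\<lambda>_. UNIV)"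
      define f where "f = dual.construct C (\<lambda>b. if b \<in> B then g b else u b)"
      have f: "functional f" unfolding f_def by (rule dual.linear_construct[OF C(2)])
      have fb: "f b = (if b \<in> B then g b else u b)" if "b \<in> C" for b
        unfolding f_def using dual.construct_basis[OF C(2) that] by simp
      have "u = restrict f (C - B)" using u fb by (intro PiE_ext[OF u]) auto
      moreover have "f \<in> {f. functional f \<and> (\<forall>b\<in>B. f b = g b)}" using f fb C(1) by auto
      ultimately show "u \<in> (\<lambda>f. restrict f (C - B)) ` {f. functional f \<and> (\<forall>b\<in>B. f b = g b)}" by blast
    qed (auto split: if_splits)
  qed
  then have "card {f. functional f \<and> (\<forall>b\<in>B. f b = g b)} = card (PiE (C - B) (\<lambda>_. UNIV :: 'k set))"
    by (rule bij_betw_same_card)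
  also have "\<dots> = q ^ card (C - B)" by (simp add: card_PiE card_field)
  also have "card (C - B) = n - card B" using C(1) cC by (simp add: card_Diff_subset)
  finally show ?thesis .
qed

lemma functional_vanish_span:
  assumes "functional f" "\<forall>b\<in>B. f b = 0" "w \<in> span B"
  shows "f w = 0"
proof -
  interpret dual: vector_space_pair scale "(*) :: 'k \<Rightarrow> 'k \<Rightarrow> 'k" by (rule dual_pair)
  show ?thesis using assms dual.linear_eq_0_on_span by blast
qed

lemma card_annihilator:
  assumes "subspace z"
  shows "card (annihilator z) = q ^ (n - dim z)"
proof -
  obtain B where B: "B \<subseteq> z" "independent B" "z \<subseteq> span B" "card B = dim z"
    using basis_exists by blast
  have "annihilator z = {f. functional f \<and> (\<forall>b\<in>B. f b = 0)}"
    unfolding annihilator_def using B(1,3) functional_vanish_span by blast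
  then show ?thesis using card_functionals_prescribed[OF B(2), of "\<lambda>_. 0"] B(4) by simp
qed

lemma annihilator_mono: "z \<subseteq> z' \<Longrightarrow> annihilator z' \<subseteq> annihilator z"
  by (auto simp: annihilator_def)

lemma dim_le_n: "dim S \<le> n"
  unfolding dim_space[symmetric] by (rule dim_subset) simp

lemma dim_span_Un:
  assumes "subspace x" "subspace y"
  shows "dim (span (x \<union> y)) + dim (x \<inter> y) = dim x + dim y"
proof -
  have "span (x \<union> y) = {a + b |a b. a \<in> x \<and> b \<in> y}"
    using assms by (auto simp: span_Un span_eq_iff[THEN iffD2])
  then show ?thesis using dim_sums_Int[OF assms] by simp
qed

lemma subspace_kernel: "functional f \<Longrightarrow> subspace {w. f w = 0}"
proof -
  assume f: "functional f"
  interpret f: Vector_Spaces.linear scale "(*)" f by fact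
  show ?thesis by (rule subspaceI) (simp_all add: f.add f.scale f.zero)
qed

text \<open>Each \<open>w\<close> in \<open>z\<close> differs from a vector of \<open>z\<close>
  killed by \<open>f\<close> by the multiple \<open>f w / f u\<close> of \<open>u\<close>, so
  \<open>u\<close> alone completes that hyperplane to \<open>z\<close>.\<close>

lemma dim_kernel_Int:
  assumes f: "functional f" and z: "subspace z" and u: "u \<in> z" "f u \<noteq> 0"
  shows "dim (z \<inter> {w. f w = 0}) + 1 = dim z"
proof -
  interpret f: Vector_Spaces.linear scale "(*)" f by fact
  let ?k = "z \<inter> {w. f w = 0}"
  have k: "subspace ?k" using z subspace_kernel[OF f] by (rule subspace_inter)
  have "u \<notin> span ?k" using u span_minimal[OF _ k, of ?k] by auto
  then have d: "dim (insert u ?k) = dim ?k + 1" by (simp add: dim_insert)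
  have "w \<in> span (insert u ?k)" if w: "w \<in> z" for w
  proof -
    have "w - scale (f w / f u) u \<in> ?k"
      using w u z by (auto simp: f.diff f.scale subspace_diff subspace_scale)
    then have "w - scale (f w / f u) u \<in> span (insert u ?k)" by (intro span_base) auto
    moreover have "scale (f w / f u) u \<in> span (insert u ?k)" by (intro span_scale span_base) auto
    ultimately show ?thesis using span_add by fastforce
  qed
  then have "dim z \<le> dim (insert u ?k)" by (intro dim_mono) auto
  moreover have "dim (insert u ?k) \<le> dim z" using u by (intro dim_subset) auto
  ultimately show ?thesis using d by simp
qed

lemma kernel_Int_eq:
  assumes "functional f" "f \<in> annihilator z"
  shows "z \<inter> {w. f w = 0} = z"
  using assms by (auto simp: annihilator_def)

subsection \<open>Neighbours of a subspace\<close>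

lemma subspaces_dimD: "x \<in> X r \<Longrightarrow> subspace x" "x \<in> X r \<Longrightarrow> dim x = r"
  by (simp_all add: subspaces_dim_def)

lemma subspaces_dim_le: "x \<in> X r \<Longrightarrow> r \<le> n"
  using dim_le_n subspaces_dimD by metis

lemma sdist_plus_dim: "sdist scale x y + dim (x \<inter> y) = dim x"
  unfolding sdist_def by (simp add: dim_subset)

lemma sdist_commute: "x \<in> X r \<Longrightarrow> y \<in> X r \<Longrightarrow> sdist scale x y = sdist scale y x"
  by (simp add: sdist_def subspaces_dimD Int_commute)

text \<open>An edge of the Grassmann graph at \<open>x\<close>, given by the hyperplane that is kept
  and the vector that is added. The span is a neighbour of \<open>x\<close> only if \<open>f\<close>
  is nonzero on \<open>x\<close> and \<open>v\<close> lies outside \<open>x\<close>, hence the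
  context below.\<close>

definition flip :: "'v set \<Rightarrow> ('v \<Rightarrow> 'k) \<Rightarrow> 'v \<Rightarrow> 'v set" where
  "flip x f v = span (insert v (x \<inter> {w. f w = 0}))"

lemma subspace_hyperplane: "functional f \<Longrightarrow> subspace x \<Longrightarrow> subspace (x \<inter> {w. f w = 0})"
  by (intro subspace_inter subspace_kernel)

lemma dim_hyperplane:
  assumes "subspace x" "functional f" "f \<notin> annihilator x"
  shows "dim (x \<inter> {w. f w = 0}) + 1 = dim x"
  using assms dim_kernel_Int unfolding annihilator_def by blast

lemma dim_Int_less:
  assumes "subspace x" "subspace y" "v \<in> y" "v \<notin> x"
  shows "dim (x \<inter> y) < dim y"
proof (rule dim_psubset)
  have "span (x \<inter> y) = x \<inter> y" "span y = y" using assms by (simp_all add: subspace_inter span_eq_iff)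
  then show "span (x \<inter> y) \<subset> span y" using assms(3,4) by (simp only:) blast
qed

context
  fixes x r f v
  assumes x: "x \<in> X r" and f: "functional f" "f \<notin> annihilator x" and v: "v \<notin> x"
begin

lemma flip_dim: "flip x f v \<in> X r"
proof -
  let ?z = "x \<inter> {w. f w = 0}"
  have "v \<notin> span ?z" using v subspace_hyperplane[OF f(1)] x subspaces_dimD by (metis IntD1 span_eq_iff)
  then show ?thesis
    using dim_hyperplane[OF subspaces_dimD(1)[OF x] f] subspaces_dimD(2)[OF x]
    by (simp add: subspaces_dim_def flip_def subspace_span dim_insert)
qed

lemma flip_superset: "x \<inter> {w. f w = 0} \<subseteq> flip x f v" "v \<in> flip x f v"
  unfolding flip_def using span_superset[of "insert v (x \<inter> {w. f w = 0})"] by auto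

text \<open>The intersection contains the hyperplane, and it misses \<open>v\<close>, so its
  dimension is at most \<open>r - 1\<close>, that of the hyperplane.\<close>

lemma flip_Int: "x \<inter> flip x f v = x \<inter> {w. f w = 0}"
proof -
  let ?z = "x \<inter> {w. f w = 0}"
  have sub: "subspace ?z" using subspace_hyperplane[OF f(1)] x subspaces_dimD by blast
  have "dim (x \<inter> flip x f v) < r"
    using dim_Int_less[of x "flip x f v" v] x flip_dim subspaces_dimD v flip_superset(2) by auto
  then have "dim (x \<inter> flip x f v) \<le> dim ?z"
    using dim_hyperplane[OF _ f] x subspaces_dimD by fastforce
  then show ?thesis
    using flip_superset(1) subspace_dim_equal[OF sub, of "x \<inter> flip x f v"] x flip_dim subspaces_dimD
    by (simp add: subspace_inter)
qed

lemma flip_sdist: "sdist scale (flip x f v) x = 1"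
proof -
  have "sdist scale (flip x f v) x + dim (x \<inter> {w. f w = 0}) = r"
    using sdist_plus_dim[of "flip x f v" x] flip_Int subspaces_dimD(2)[OF flip_dim] by (simp add: Int_commute)
  then show ?thesis using dim_hyperplane[OF _ f] subspaces_dimD[OF x] by simp
qed

text \<open>Both \<open>x \<inter> y\<close> and the hyperplane cut out by \<open>f\<close> have
  dimension \<open>r - 1\<close>, so an inclusion makes them equal; adding \<open>v\<close> then
  fills \<open>y\<close>. Every fibre of \<open>flip x\<close> over a neighbour is thus a product
  set.\<close>

lemma flip_eq_iff:
  assumes y: "y \<in> X r" "sdist scale y x = 1"
  shows "flip x f v = y \<longleftrightarrow> f \<in> annihilator (x \<inter> y) \<and> v \<in> y"
proof
  assume "flip x f v = y"
  then show "f \<in> annihilator (x \<inter> y) \<and> v \<in> y"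
    using flip_Int flip_superset(2) f(1) by (auto simp: annihilator_def)
next
  let ?z = "x \<inter> {w. f w = 0}"
  assume a: "f \<in> annihilator (x \<inter> y) \<and> v \<in> y"
  have sx: "subspace x" "dim x = r" "subspace y" "dim y = r" using x y subspaces_dimD by auto
  have "x \<inter> y \<subseteq> ?z" using a by (auto simp: annihilator_def)
  moreover have "dim (x \<inter> y) + 1 = dim x" using sdist_plus_dim[of y x] y(2) sx by (simp add: Int_commute)
  then have "dim ?z \<le> dim (x \<inter> y)" using dim_hyperplane[OF sx(1) f] by simp
  ultimately have "x \<inter> y = ?z" using subspace_dim_equal[of "x \<inter> y" ?z] sx subspace_hyperplane[OF f(1)]
    by (simp add: subspace_inter)
  then have "flip x f v \<subseteq> y" unfolding flip_def using a sx by (intro span_minimal) auto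
  then show "flip x f v = y" using subspace_dim_equal[of "flip x f v" y] flip_dim subspaces_dimD sx by auto
qed

text \<open>Adding the hyperplane \<open>z\<close> and the vector \<open>v\<close> one after the other, the intersection with \<open>x'\<close>
  drops with \<open>z\<close> unless \<open>f\<close> vanishes on it, and grows with \<open>v\<close> iff \<open>v\<close> lies in \<open>z + x'\<close>.\<close>

lemma dim_flip_Int:
  assumes x': "subspace x'"
  shows "dim (flip x f v \<inter> x') + (if f \<in> annihilator (x \<inter> x') then 0 else 1) =
    dim (x \<inter> x') + (if v \<in> span (x \<inter> {w. f w = 0} \<union> x') then 1 else 0)"
proof -
  let ?z = "x \<inter> {w. f w = 0}"
  have sx: "subspace x" "dim x = r" using x subspaces_dimD by auto
  have sz: "subspace ?z" using subspace_hyperplane[OF f(1)] sx by blast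
  have sI: "subspace (x \<inter> x')" using sx x' by (simp add: subspace_inter)
  have eq: "?z \<inter> x' = (x \<inter> x') \<inter> {w. f w = 0}" by auto
  have 1: "dim (?z \<inter> x') + (if f \<in> annihilator (x \<inter> x') then 0 else 1) = dim (x \<inter> x')"
    using kernel_Int_eq[OF f(1), of "x \<inter> x'"] dim_hyperplane[OF sI f(1)] unfolding eq by auto
  have "span (flip x f v \<union> x') = span (insert v (?z \<union> x'))"
  proof (intro equalityI span_minimal subspace_span)
    have "flip x f v \<subseteq> span (insert v (?z \<union> x'))" unfolding flip_def by (intro span_mono) auto
    moreover have "x' \<subseteq> span (insert v (?z \<union> x'))" using span_superset[of "insert v (?z \<union> x')"] by auto
    ultimately show "flip x f v \<union> x' \<subseteq> span (insert v (?z \<union> x'))" by auto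
    show "insert v (?z \<union> x') \<subseteq> span (flip x f v \<union> x')"
      using flip_superset span_superset[of "flip x f v \<union> x'"] by auto
  qed
  then have 2: "dim (span (flip x f v \<union> x')) = dim (span (?z \<union> x')) + (if v \<in> span (?z \<union> x') then 0 else 1)"
    by (simp add: dim_insert)
  have 3: "dim (span (flip x f v \<union> x')) + dim (flip x f v \<inter> x') = r + dim x'"
    using dim_span_Un[OF _ x', of "flip x f v"] flip_dim subspaces_dimD by auto
  have 4: "dim (span (?z \<union> x')) + dim (?z \<inter> x') = dim ?z + dim x'" by (rule dim_span_Un[OF sz x'])
  have 5: "dim ?z + 1 = r" using dim_hyperplane[OF sx(1) f] sx(2) by simp
  show ?thesis using 1 2 3 4 5 by (auto split: if_splits)
qed

end

section \<open>Double counting of neighbours by pairs of a functional and a vector\<close>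

definition flip_pairs :: "'v set \<Rightarrow> (('v \<Rightarrow> 'k) \<times> 'v) set" where
  "flip_pairs x = {(f, v). functional f \<and> f \<notin> annihilator x \<and> v \<notin> x}"

text \<open>By \<open>flip_eq_iff\<close> the fibre over \<open>y\<close> consists of a functional
  killing \<open>x \<inter> y\<close> but not \<open>x\<close> and a vector of \<open>y - x\<close>,
  chosen independently; its size does not involve \<open>y\<close>.\<close>

lemma card_flip_fibres:
  assumes x: "x \<in> X r" and Y: "Y \<subseteq> {y \<in> X r. sdist scale y x = 1}"
  shows "card {(f, v) \<in> flip_pairs x. flip x f v \<in> Y} =
    card Y * ((q ^ (n - r + 1) - q ^ (n - r)) * (q ^ r - q ^ (r - 1)))"
proof -
  have sx: "subspace x" "dim x = r" using x subspaces_dimD by auto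
  have fin: "finite (flip_pairs x)"
    by (rule finite_subset[OF subset_UNIV]) (simp flip: UNIV_Times_UNIV)
  have fib: "card {(f, v) \<in> flip_pairs x. flip x f v = y} =
    (q ^ (n - r + 1) - q ^ (n - r)) * (q ^ r - q ^ (r - 1))" if "y \<in> Y" for y
  proof -
    have y: "y \<in> X r" "sdist scale y x = 1" using that Y by auto
    then have sy: "subspace y" "dim y = r" using subspaces_dimD by auto
    have sI: "subspace (x \<inter> y)" using sx sy by (simp add: subspace_inter)
    have dI: "dim (x \<inter> y) + 1 = r" using sdist_plus_dim[of y x] y(2) sy by (simp add: Int_commute)
    have "{(f, v) \<in> flip_pairs x. flip x f v = y} = (annihilator (x \<inter> y) - annihilator x) \<times> (y - x)"
      using flip_eq_iff[OF x _ _ _ y] by (auto simp: flip_pairs_def annihilator_def)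
    moreover have "n - dim (x \<inter> y) = n - r + 1" using dI subspaces_dim_le[OF x] by auto
    then have "card (annihilator (x \<inter> y) - annihilator x) = q ^ (n - r + 1) - q ^ (n - r)"
      using card_annihilator[OF sI] card_annihilator[OF sx(1)] annihilator_mono[of "x \<inter> y" x] sx(2)
      by (subst card_Diff_subset) auto
    moreover have "card (y - x) = card (y - x \<inter> y)" by (rule arg_cong[of _ _ card]) auto
    then have "card (y - x) = card y - card (x \<inter> y)" using card_Diff_subset[of "x \<inter> y" y] by simp
    then have "card (y - x) = q ^ r - q ^ (r - 1)"
      using card_subspace[OF sI] card_subspace[OF sy(1)] dI sy(2) by auto
    ultimately show ?thesis by (simp add: card_cartesian_product)
  qed
  have "{(f, v) \<in> flip_pairs x. flip x f v \<in> Y} = (\<Union>y\<in>Y. {(f, v) \<in> flip_pairs x. flip x f v = y})"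
    by auto
  also have "card \<dots> = (\<Sum>y\<in>Y. card {(f, v) \<in> flip_pairs x. flip x f v = y})"
    by (rule card_UN_disjoint) (auto intro: finite_subset[OF _ fin])
  finally show ?thesis using fib by simp
qed

context
  fixes x1 x2 r1 r2 i
  assumes x1: "x1 \<in> X r1" and x2: "x2 \<in> X r2" and i: "dim (x2 \<inter> x1) = i"
begin

text \<open>By \<open>dim_flip_Int\<close> the intersection with \<open>x1\<close> shrinks exactly
  when \<open>f\<close> is nonzero on \<open>x2 \<inter> x1\<close> and \<open>v\<close> lies
  outside \<open>x2 + x1\<close>, two independent choices. The fibre size stays as a factor to avoid
  division in \<open>nat\<close>.\<close>

lemma card_neighbours_away:
  "card {y \<in> X r2. sdist scale y x2 = 1 \<and> dim (y \<inter> x1) + 1 = i} *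
     ((q ^ (n - r2 + 1) - q ^ (n - r2)) * (q ^ r2 - q ^ (r2 - 1))) =
   (q ^ n - q ^ (n - i)) * (q ^ n - q ^ (r1 + r2 - i))" (is "card ?Y * _ = _")
proof -
  have s: "subspace x1" "dim x1 = r1" "subspace x2" "dim x2 = r2" using x1 x2 subspaces_dimD by auto
  have sI: "subspace (x2 \<inter> x1)" using s by (simp add: subspace_inter)
  have dU: "dim (span (x2 \<union> x1)) = r1 + r2 - i" using dim_span_Un[OF s(3,1)] i s by simp
  have iff: "flip x2 f v \<in> ?Y \<longleftrightarrow> f \<notin> annihilator (x2 \<inter> x1) \<and> v \<notin> span (x2 \<union> x1)"
    if "(f, v) \<in> flip_pairs x2" for f v
  proof -
    have f: "functional f" "f \<notin> annihilator x2" and v: "v \<notin> x2" using that by (auto simp: flip_pairs_def)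
    let ?z = "x2 \<inter> {w. f w = 0}"
    \<comment> \<open>When \<open>f\<close> is nonzero on the intersection, passing from
      \<open>x2\<close> to its hyperplane loses nothing in the sum with \<open>x1\<close>, so the
      condition on \<open>v\<close> no longer depends on \<open>f\<close>.\<close>
    have "span (?z \<union> x1) = span (x2 \<union> x1)" if na: "f \<notin> annihilator (x2 \<inter> x1)"
    proof -
      have "?z \<inter> x1 = (x2 \<inter> x1) \<inter> {w. f w = 0}" by auto
      then have "dim (?z \<inter> x1) + 1 = i" using dim_hyperplane[OF sI f(1) na] i by simp
      moreover have "dim (span (?z \<union> x1)) + dim (?z \<inter> x1) = dim ?z + r1"
        using dim_span_Un[OF subspace_hyperplane[OF f(1) s(3)] s(1)] s by simp
      moreover have "dim ?z + 1 = r2" using dim_hyperplane[OF s(3) f] s by simp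
      ultimately have "dim (span (x2 \<union> x1)) \<le> dim (span (?z \<union> x1))" using dU by simp
      then show ?thesis
        by (intro subspace_dim_equal subspace_span span_mono) auto
    qed
    then show ?thesis
      using dim_flip_Int[OF x2 f v s(1)] flip_dim[OF x2 f v] flip_sdist[OF x2 f v] i by (auto split: if_splits)
  qed
  \<comment> \<open>The conditions of \<open>flip_pairs\<close> come for free: \<open>f\<close> is
    nonzero on a subset of \<open>x2\<close>, and \<open>x2\<close> lies inside the sum that
    \<open>v\<close> avoids.\<close>
  have "(f, v) \<in> flip_pairs x2 \<and> flip x2 f v \<in> ?Y \<longleftrightarrow>
      f \<in> annihilator {} - annihilator (x2 \<inter> x1) \<and> v \<in> UNIV - span (x2 \<union> x1)" for f v
  proof -
    have "(f, v) \<in> flip_pairs x2 \<longleftrightarrow> f \<in> annihilator {} \<and> f \<notin> annihilator x2 \<and> v \<notin> x2"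
      by (auto simp: flip_pairs_def annihilator_def)
    then show ?thesis
      using iff[of f v] annihilator_mono[of "x2 \<inter> x1" x2] span_superset[of "x2 \<union> x1"] by blast
  qed
  then have "{(f, v) \<in> flip_pairs x2. flip x2 f v \<in> ?Y} =
    (annihilator {} - annihilator (x2 \<inter> x1)) \<times> (UNIV - span (x2 \<union> x1))"
    by blast
  moreover have "annihilator {} = annihilator {0}"
    using functional_vanish_span[of _ "{}"] by (auto simp: annihilator_def)
  then have "card (annihilator {} - annihilator (x2 \<inter> x1)) = q ^ n - q ^ (n - i)"
    using card_annihilator[OF subspace_single_0] card_annihilator[OF sI] i
    by (subst card_Diff_subset) (auto simp: annihilator_def)
  moreover have "card (UNIV - span (x2 \<union> x1)) = q ^ n - q ^ (r1 + r2 - i)"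
    using card_subspace[OF subspace_UNIV] card_subspace[OF subspace_span, of "x2 \<union> x1"] dU dim_space
    by (subst card_Diff_subset) auto
  moreover have "card {(f, v) \<in> flip_pairs x2. flip x2 f v \<in> ?Y} =
    card ?Y * ((q ^ (n - r2 + 1) - q ^ (n - r2)) * (q ^ r2 - q ^ (r2 - 1)))"
    by (rule card_flip_fibres[OF x2]) auto
  ultimately show ?thesis by (simp add: card_cartesian_product)
qed

text \<open>Now \<open>f\<close> must vanish on \<open>x2 \<inter> x1\<close> and \<open>v\<close>
  must lie in the hyperplane plus \<open>x1\<close>. The set of admissible \<open>v\<close> varies
  with \<open>f\<close>, but its size does not, so the pairs form a \<open>Sigma\<close> with fibres
  of equal size.\<close>

lemma card_neighbours_towards:
  "card {y \<in> X r2. sdist scale y x2 = 1 \<and> dim (y \<inter> x1) = i + 1} *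
     ((q ^ (n - r2 + 1) - q ^ (n - r2)) * (q ^ r2 - q ^ (r2 - 1))) =
   (q ^ (n - i) - q ^ (n - r2)) * (q ^ (r1 + r2 - 1 - i) - q ^ (r2 - 1))" (is "card ?Y * _ = _")
proof -
  have s: "subspace x1" "dim x1 = r1" "subspace x2" "dim x2 = r2" using x1 x2 subspaces_dimD by auto
  have sI: "subspace (x2 \<inter> x1)" using s by (simp add: subspace_inter)
  have dU: "dim (span (x2 \<union> x1)) + i = r1 + r2" using dim_span_Un[OF s(3,1)] i s by simp
  let ?z = "\<lambda>f. x2 \<inter> {w. f w = 0}"
  let ?A = "annihilator (x2 \<inter> x1) - annihilator x2"
  have iff: "flip x2 f v \<in> ?Y \<longleftrightarrow> f \<in> annihilator (x2 \<inter> x1) \<and> v \<in> span (?z f \<union> x1)"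
    if "(f, v) \<in> flip_pairs x2" for f v
  proof -
    have f: "functional f" "f \<notin> annihilator x2" and v: "v \<notin> x2" using that by (auto simp: flip_pairs_def)
    then show ?thesis
      using dim_flip_Int[OF x2 f v s(1)] flip_dim[OF x2 f v] flip_sdist[OF x2 f v] i by (auto split: if_splits)
  qed
  have c: "card (span (?z f \<union> x1) - x2) = q ^ (r1 + r2 - 1 - i) - q ^ (r2 - 1)" if "f \<in> ?A" for f
  proof -
    have f: "functional f" "f \<notin> annihilator x2" using that by (auto simp: annihilator_def)
    have sz: "subspace (?z f)" using subspace_hyperplane[OF f(1) s(3)] .
    have "?z f \<inter> x1 = (x2 \<inter> x1) \<inter> {w. f w = 0}" by auto
    also have "\<dots> = x2 \<inter> x1" using kernel_Int_eq[OF f(1)] that by auto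
    finally have d: "dim (span (?z f \<union> x1)) + i = dim (?z f) + r1"
      using dim_span_Un[OF sz s(1)] s i by simp
    have dz: "dim (?z f) + 1 = r2" using dim_hyperplane[OF s(3) f] s by simp
    \<comment> \<open>The hyperplane plus \<open>x1\<close> has one dimension less than
      \<open>x2 + x1\<close>, so it meets \<open>x2\<close> in the hyperplane only; this counts the
      vectors to be discarded.\<close>
    have "\<not> x2 \<subseteq> span (?z f \<union> x1)"
    proof
      assume "x2 \<subseteq> span (?z f \<union> x1)"
      then have "span (x2 \<union> x1) \<subseteq> span (?z f \<union> x1)"
        using span_superset[of "?z f \<union> x1"] by (intro span_minimal subspace_span) auto
      then show False using dim_subset[of "span (x2 \<union> x1)" "span (?z f \<union> x1)"] d dz dU by simp
    qed
    then obtain u where "u \<in> x2" "u \<notin> span (?z f \<union> x1)" by auto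
    then have "dim (span (?z f \<union> x1) \<inter> x2) < r2"
      using dim_Int_less[OF subspace_span s(3)] s(4) by simp
    moreover have sub: "?z f \<subseteq> span (?z f \<union> x1) \<inter> x2" using span_superset[of "?z f \<union> x1"] by auto
    ultimately have eq: "?z f = span (?z f \<union> x1) \<inter> x2"
      using dz s by (intro subspace_dim_equal sz subspace_inter subspace_span) auto
    have "span (?z f \<union> x1) - x2 = span (?z f \<union> x1) - ?z f" using eq by blast
    then have "card (span (?z f \<union> x1) - x2) = card (span (?z f \<union> x1)) - card (?z f)"
      using sub by (simp only:) (rule card_Diff_subset, auto)
    also have "\<dots> = q ^ dim (span (?z f \<union> x1)) - q ^ dim (?z f)"
      using card_subspace[OF sz] card_subspace[OF subspace_span, of "?z f \<union> x1"] by simp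
    also have "dim (span (?z f \<union> x1)) = r1 + r2 - 1 - i" using d dz by simp
    also have "dim (?z f) = r2 - 1" using dz by simp
    finally show ?thesis .
  qed
  have "(f, v) \<in> flip_pairs x2 \<and> flip x2 f v \<in> ?Y \<longleftrightarrow> f \<in> ?A \<and> v \<in> span (?z f \<union> x1) - x2" for f v
  proof -
    have "(f, v) \<in> flip_pairs x2 \<longleftrightarrow> functional f \<and> f \<notin> annihilator x2 \<and> v \<notin> x2"
      by (simp add: flip_pairs_def)
    moreover have "f \<in> annihilator (x2 \<inter> x1) \<Longrightarrow> functional f" by (simp add: annihilator_def)
    ultimately show ?thesis using iff[of f v] by blast
  qed
  then have "{(f, v) \<in> flip_pairs x2. flip x2 f v \<in> ?Y} = Sigma ?A (\<lambda>f. span (?z f \<union> x1) - x2)"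
    by blast
  then have "card {(f, v) \<in> flip_pairs x2. flip x2 f v \<in> ?Y} = card ?A * (q ^ (r1 + r2 - 1 - i) - q ^ (r2 - 1))"
    using c by simp
  moreover have "card ?A = q ^ (n - i) - q ^ (n - r2)"
    using card_annihilator[OF s(3)] card_annihilator[OF sI] i s annihilator_mono[of "x2 \<inter> x1" x2]
    by (subst card_Diff_subset) auto
  moreover have "card {(f, v) \<in> flip_pairs x2. flip x2 f v \<in> ?Y} =
    card ?Y * ((q ^ (n - r2 + 1) - q ^ (n - r2)) * (q ^ r2 - q ^ (r2 - 1)))"
    by (rule card_flip_fibres[OF x2]) auto
  ultimately show ?thesis by simp
qed

end

end

section \<open>Solving the counting equations\<close>

lemma away_count_formula:
  fixes Q N :: real and i j t m :: nat
  assumes Q: "Q > 1" and pos: "i + t \<ge> 1"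
    and eq: "N * ((Q ^ (j + m + 1) - Q ^ (j + m)) * (Q ^ (i + t) - Q ^ (i + t - 1))) =
      (Q ^ (i + j + t + m) - Q ^ (j + t + m)) * (Q ^ (i + j + t + m) - Q ^ (i + j + t))"
  shows "N = Q powi (int (i + j) - int (i + t) + 1) * (Q powi int t - Q ^ (i + t)) *
    (Q powi int t - Q powi (int (i + j + t + m) - int (i + j))) / (Q - 1)\<^sup>2"
proof -
  \<comment> \<open>The parameters stand for \<open>i = dim (x2 \<inter> x1)\<close>,
    \<open>j = r1 - i\<close>, the distance \<open>t\<close> and the codimension \<open>m\<close> of
    \<open>x1 + x2\<close>; thus \<open>r1 = i + j\<close>, \<open>r2 = i + t\<close> and
    \<open>n = i + j + t + m\<close>.\<close>
  have 1: "Q powi (int (i + j) - int (i + t) + 1) = Q ^ j / Q ^ t * Q"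
    using Q by (simp add: power_int_diff power_int_add)
  have 2: "Q powi (int (i + j + t + m) - int (i + j)) = Q ^ t * Q ^ m"
    using Q by (simp add: power_int_diff power_int_add power_add)
  have 3: "Q ^ (i + t - 1) = Q ^ i * Q ^ t / Q"
    using Q pos by (simp add: power_diff power_add)
  \<comment> \<open>The powers become independent nonzero variables, which turns the claim into an
    identity of rational functions.\<close>
  have "N = J / T * Q * (T - I * T) * (T - T * M) / (Q - 1)\<^sup>2"
    if nz: "I \<noteq> 0" "J \<noteq> 0" "T \<noteq> 0" "M \<noteq> 0"
      and eq: "N * ((J * M * Q - J * M) * (I * T - I * T / Q)) = (I * J * T * M - J * T * M) * (I * J * T * M - I * J * T)"
    for I J T M :: real
  proof -
    have D: "(J * M * Q - J * M) * (I * T - I * T / Q) = J * M * I * T * (Q - 1)\<^sup>2 / Q"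
      using Q by (simp add: field_simps power2_eq_square)
    have "J / T * Q * (T - I * T) * (T - T * M) / (Q - 1)\<^sup>2 * (J * M * I * T * (Q - 1)\<^sup>2 / Q) =
        (I * J * T * M - J * T * M) * (I * J * T * M - I * J * T)"
      using Q nz by (simp add: divide_simps) (simp add: algebra_simps)
    then have "N * (J * M * I * T * (Q - 1)\<^sup>2 / Q) =
        J / T * Q * (T - I * T) * (T - T * M) / (Q - 1)\<^sup>2 * (J * M * I * T * (Q - 1)\<^sup>2 / Q)"
      using eq unfolding D by simp
    moreover have "J * M * I * T * (Q - 1)\<^sup>2 / Q \<noteq> 0" using Q nz by simp
    ultimately show ?thesis using mult_right_cancel by blast
  qed
  from this[of "Q ^ i" "Q ^ j" "Q ^ t" "Q ^ m"] show ?thesis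
    using eq[unfolded 3] Q unfolding 1 2 power_add power_one_right by simp
qed

lemma towards_count_formula:
  fixes Q N :: real and i j t m :: nat
  assumes Q: "Q > 1" and pos: "i + t \<ge> 1"
    and eq: "N * ((Q ^ (j + m + 1) - Q ^ (j + m)) * (Q ^ (i + t) - Q ^ (i + t - 1))) =
      (Q ^ (j + t + m) - Q ^ (j + m)) * (Q ^ (i + j + t - 1) - Q ^ (i + t - 1))"
  shows "N = Q powi (int (i + j) - int (i + t)) * (Q powi int t - 1) *
    (Q powi int t - Q powi (int (i + t) - int (i + j))) / (Q - 1)\<^sup>2"
proof -
  have 1: "Q powi (int (i + j) - int (i + t)) = Q ^ j / Q ^ t"
    using Q by (simp add: power_int_diff)
  have 2: "Q powi (int (i + t) - int (i + j)) = Q ^ t / Q ^ j"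
    using Q by (simp add: power_int_diff)
  have 3: "Q ^ (i + t - 1) = Q ^ i * Q ^ t / Q" "Q ^ (i + j + t - 1) = Q ^ i * Q ^ j * Q ^ t / Q"
    using Q pos by (simp_all add: power_diff power_add)
  have "N = J / T * (T - 1) * (T - T / J) / (Q - 1)\<^sup>2"
    if nz: "I \<noteq> 0" "J \<noteq> 0" "T \<noteq> 0" "M \<noteq> 0"
      and eq: "N * ((J * M * Q - J * M) * (I * T - I * T / Q)) = (J * T * M - J * M) * (I * J * T / Q - I * T / Q)"
    for I J T M :: real
  proof -
    have D: "(J * M * Q - J * M) * (I * T - I * T / Q) = J * M * I * T * (Q - 1)\<^sup>2 / Q"
      using Q by (simp add: field_simps power2_eq_square)
    have "J / T * (T - 1) * (T - T / J) / (Q - 1)\<^sup>2 * (J * M * I * T * (Q - 1)\<^sup>2 / Q) =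
        (J * T * M - J * M) * (I * J * T / Q - I * T / Q)"
      using Q nz by (simp add: divide_simps) (simp add: algebra_simps)
    then have "N * (J * M * I * T * (Q - 1)\<^sup>2 / Q) =
        J / T * (T - 1) * (T - T / J) / (Q - 1)\<^sup>2 * (J * M * I * T * (Q - 1)\<^sup>2 / Q)"
      using eq unfolding D by simp
    moreover have "J * M * I * T * (Q - 1)\<^sup>2 / Q \<noteq> 0" using Q nz by simp
    ultimately show ?thesis using mult_right_cancel by blast
  qed
  from this[of "Q ^ i" "Q ^ j" "Q ^ t" "Q ^ m"] show ?thesis
    using eq[unfolded 3] Q unfolding 1 2 power_add power_one_right by simp
qed

section \<open>Closed forms of the two coefficients\<close>

context finite_field_space
begin

text \<open>Among subspaces of dimension \<open>r2\<close> the distance to \<open>x1\<close> is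
  \<open>r2\<close> minus the dimension of the intersection, so one grows as the other shrinks.
  Writing \<open>+ 1\<close> on the smaller side avoids truncated subtraction.\<close>

lemma neighbours_at_eq:
  assumes "x1 \<in> X r1" "x2 \<in> X r2"
  shows "neighbours_at scale r2 x1 x2 (int (sdist scale x2 x1) + 1) =
      {y \<in> X r2. sdist scale y x2 = 1 \<and> dim (y \<inter> x1) + 1 = dim (x2 \<inter> x1)}" (is ?away)
    and "neighbours_at scale r2 x1 x2 (int (sdist scale x2 x1) - 1) =
      {y \<in> X r2. sdist scale y x2 = 1 \<and> dim (y \<inter> x1) = dim (x2 \<inter> x1) + 1}" (is ?towards)
proof -
  have x2: "sdist scale x2 x1 + dim (x2 \<inter> x1) = r2" using sdist_plus_dim[of x2 x1] assms subspaces_dimD by auto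
  have y: "sdist scale y x1 + dim (y \<inter> x1) = r2" if "y \<in> X r2" for y
    using sdist_plus_dim[of y x1] that subspaces_dimD by auto
  show ?away unfolding neighbours_at_def
    by (intro Collect_cong conj_cong refl) (use x2 y in force)
  show ?towards unfolding neighbours_at_def
    by (intro Collect_cong conj_cong refl) (use x2 y in force)
qed

lemma real_q_power_diff: "a \<le> b \<Longrightarrow> real (q ^ b - q ^ a) = real q ^ b - real q ^ a"
  using q_ge_2 by (simp add: of_nat_diff power_increasing)

lemma card_neighbours_at:
  assumes x1: "x1 \<in> X r1" and x2: "x2 \<in> X r2"
  defines "t \<equiv> int (sdist scale x2 x1)"
  shows "real (card (neighbours_at scale r2 x1 x2 (t + 1))) =
      real q powi (int r1 - int r2 + 1) * (real q powi t - real q ^ r2) *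
      (real q powi t - real q powi (int n - int r1)) / (real q - 1)\<^sup>2" (is ?away)
    and "real (card (neighbours_at scale r2 x1 x2 (t - 1))) =
      real q powi (int r1 - int r2) * (real q powi t - 1) *
      (real q powi t - real q powi (int r2 - int r1)) / (real q - 1)\<^sup>2" (is ?towards)
proof -
  define i where "i = dim (x2 \<inter> x1)"
  define d where "d = sdist scale x2 x1"
  have s: "subspace x1" "dim x1 = r1" "subspace x2" "dim x2 = r2" using x1 x2 subspaces_dimD by auto
  have r2: "r2 = i + d" using sdist_plus_dim[of x2 x1] s unfolding i_def d_def by simp
  have "i \<le> r1" using s unfolding i_def by (metis dim_subset inf_le2)
  \<comment> \<open>\<open>j\<close> is the dimension of \<open>x1\<close> modulo the intersection,
    and \<open>m\<close> below is the codimension of \<open>x1 + x2\<close>.\<close>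
  then obtain j where r1: "r1 = i + j" using le_Suc_ex by blast
  have "dim (span (x2 \<union> x1)) + i = r2 + r1" using dim_span_Un[OF s(3,1)] s i_def by simp
  then have "i + j + d \<le> n" using dim_le_n[of "span (x2 \<union> x1)"] r1 r2 by simp
  then obtain m where n: "n = i + j + d + m" using le_Suc_ex by blast
  have Q: "real q > 1" using q_ge_2 by simp
  have ix: "dim (x2 \<inter> x1) = i" by (simp add: i_def)
  have t: "t = int d" by (simp add: t_def d_def)
  note away = card_neighbours_away[OF x1 x2 ix] and towards = card_neighbours_towards[OF x1 x2 ix]
  have idx: "n - r2 + 1 = j + m + 1" "n - r2 = j + m" "n - i = j + d + m" "r1 + r2 - i = i + j + d"
    "r1 + r2 - 1 - i = i + j + d - 1"
    using r1 r2 n by auto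
  note N = neighbours_at_eq[OF x1 x2, folded t_def, unfolded ix]
  show ?away
  proof (cases "r2 = 0")
    \<comment> \<open>For \<open>r2 = 0\<close> the fibre size \<open>q ^ 0 - q ^ (0 - 1)\<close> is
      0 in \<open>nat\<close>, so the counting equation says nothing; but there are no neighbours,
      and the formula vanishes at \<open>t = 0\<close>.\<close>
    case True
    then have "neighbours_at scale r2 x1 x2 (t + 1) = {}"
      by (auto simp: neighbours_at_def sdist_def subspaces_dim_def simp del: dim_eq_0)
    then show ?thesis using True r2 t by simp
  next
    case False
    have "real (card (neighbours_at scale r2 x1 x2 (t + 1))) *
        ((real q ^ (j + m + 1) - real q ^ (j + m)) * (real q ^ (i + d) - real q ^ (i + d - 1))) =
      (real q ^ (i + j + d + m) - real q ^ (j + d + m)) * (real q ^ (i + j + d + m) - real q ^ (i + j + d))"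
      using arg_cong[OF away, of real] unfolding N idx of_nat_mult unfolding n r2
      by (simp add: real_q_power_diff del: power_Suc)
    moreover have "i + d \<ge> 1" using False r2 by linarith
    ultimately show ?thesis using away_count_formula[OF Q] by (simp only: r1 r2 n t)
  qed
  show ?towards
  proof (cases "r2 = 0")
    case True
    then have "neighbours_at scale r2 x1 x2 (t - 1) = {}"
      by (auto simp: neighbours_at_def sdist_def subspaces_dim_def simp del: dim_eq_0)
    then show ?thesis using True r2 t by simp
  next
    case False
    have "real (card (neighbours_at scale r2 x1 x2 (t - 1))) *
        ((real q ^ (j + m + 1) - real q ^ (j + m)) * (real q ^ (i + d) - real q ^ (i + d - 1))) =
      (real q ^ (j + d + m) - real q ^ (j + m)) * (real q ^ (i + j + d - 1) - real q ^ (i + d - 1))"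
      using arg_cong[OF towards, of real] unfolding N idx of_nat_mult unfolding n r2
      by (simp add: real_q_power_diff del: power_Suc)
    moreover have "i + d \<ge> 1" using False r2 by linarith
    ultimately show ?thesis using towards_count_formula[OF Q] by (simp only: r1 r2 n t)
  qed
qed

text \<open>Coordinate subspaces suffice: \<open>A\<close> and \<open>C\<close> are subsets of a
  basis with exactly the \<open>i\<close> vectors of \<open>B\<close> in common. A pair is needed
  because \<open>b_coeff\<close> and \<open>c_coeff\<close> are definite descriptions, which single
  out a number only if some pair realizes \<open>t\<close>.\<close>

lemma exists_pair_at_distance:
  assumes r: "r1 \<le> n" "r2 \<le> n" and t: "t \<in> I_set n r1 r2"
  obtains x1 x2 where "x1 \<in> X r1" "x2 \<in> X r2" "int (sdist scale x2 x1) = t"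
proof -
  obtain d where d: "t = int d" using t by (auto simp: I_set_def dest: nonneg_int_cases)
  obtain i where i: "r2 = i + d" using t d by (auto simp: I_set_def dest: le_Suc_ex)
  have le: "i \<le> r1" "r1 + d \<le> n" using t r unfolding I_set_def d i by auto
  have "card Basis = n" using dim_UNIV dim_space by simp
  then obtain S where S: "S \<subseteq> Basis" "card S = r1 + d"
    using le(2) obtain_subset_with_card_n by metis
  then obtain A where A: "A \<subseteq> S" "card A = r1" using obtain_subset_with_card_n[of r1 S] by auto
  then obtain B where B: "B \<subseteq> A" "card B = i" using le(1) obtain_subset_with_card_n by metis
  define C where "C = B \<union> (S - A)"
  have "card (S - A) = d" using A S by (simp add: card_Diff_subset)
  then have C: "card C = r2" unfolding C_def i using A B by (subst card_Un_disjoint) auto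
  have AC: "A \<union> C = S" using A B by (auto simp: C_def)
  have ind: "independent S" using S independent_Basis independent_mono by blast
  then have "independent A" "independent C" using AC independent_mono by blast+
  then have 1: "span A \<in> X r1" "span C \<in> X r2"
    using A(2) C by (simp_all add: subspaces_dim_def subspace_span dim_eq_card_independent)
  have "span (span C \<union> span A) = span S"
    unfolding AC[symmetric]
    by (intro equalityI span_minimal subspace_span Un_least span_mono)
      (use span_superset in blast)+
  then have "r1 + d + dim (span C \<inter> span A) = r2 + r1"
    using dim_span_Un[of "span C" "span A"] 1(1,2)[THEN subspaces_dimD(1)] 1(1,2)[THEN subspaces_dimD(2)] ind S(2)
    by (simp add: dim_eq_card_independent)
  then have "sdist scale (span C) (span A) = d"
    using sdist_plus_dim[of "span C" "span A"] subspaces_dimD(2)[OF 1(2)] by simp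
  then show thesis using that 1 d by blast
qed

text \<open>The closed form depends on the pair only through \<open>t\<close>, and the given pair
  makes the described number unique.\<close>

lemma coeff_eq_card:
  assumes x1: "x1 \<in> X r1" and x2: "x2 \<in> X r2" and t: "int (sdist scale x2 x1) = t"
  shows "b_coeff scale r1 r2 t = card (neighbours_at scale r2 x1 x2 (t + 1))"
    and "c_coeff scale r1 r2 t = card (neighbours_at scale r2 x1 x2 (t - 1))"
proof -
  have "card (neighbours_at scale r2 y1 y2 (t + 1)) = card (neighbours_at scale r2 x1 x2 (t + 1))"
      "card (neighbours_at scale r2 y1 y2 (t - 1)) = card (neighbours_at scale r2 x1 x2 (t - 1))"
    if "y1 \<in> X r1" "y2 \<in> X r2" "int (sdist scale y2 y1) = t" for y1 y2
    using card_neighbours_at[OF that(1,2)] card_neighbours_at[OF x1 x2] t that(3)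
    by (metis of_nat_eq_iff)+
  then show "b_coeff scale r1 r2 t = card (neighbours_at scale r2 x1 x2 (t + 1))"
    and "c_coeff scale r1 r2 t = card (neighbours_at scale r2 x1 x2 (t - 1))"
    unfolding b_coeff_def c_coeff_def using x1 x2 t by (blast intro!: the_equality)+
qed

lemma coeff_formulas:
  assumes "r1 \<le> n" "r2 \<le> n" "t \<in> I_set n r1 r2"
  shows "real (b_coeff scale r1 r2 t) =
      real q powi (int r1 - int r2 + 1) * (real q powi t - real q ^ r2) *
      (real q powi t - real q powi (int n - int r1)) / (real q - 1)\<^sup>2"
    and "real (c_coeff scale r1 r2 t) =
      real q powi (int r1 - int r2) * (real q powi t - 1) *
      (real q powi t - real q powi (int r2 - int r1)) / (real q - 1)\<^sup>2"
proof -
  obtain x1 x2 where x: "x1 \<in> X r1" "x2 \<in> X r2" "int (sdist scale x2 x1) = t"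
    using exists_pair_at_distance[OF assms] by blast
  show "real (b_coeff scale r1 r2 t) =
      real q powi (int r1 - int r2 + 1) * (real q powi t - real q ^ r2) *
      (real q powi t - real q powi (int n - int r1)) / (real q - 1)\<^sup>2"
    and "real (c_coeff scale r1 r2 t) =
      real q powi (int r1 - int r2) * (real q powi t - 1) *
      (real q powi t - real q powi (int r2 - int r1)) / (real q - 1)\<^sup>2"
    using card_neighbours_at[OF x(1,2)] coeff_eq_card[OF x] x(3) by simp_all
qed

text \<open>The interval can be left only at an endpoint, and there a factor of the closed form is
  0.\<close>

lemma coeff_eq_0:
  assumes "r1 \<le> n" "r2 \<le> n" "t \<in> I_set n r1 r2"
  shows "t + 1 \<notin> I_set n r1 r2 \<Longrightarrow> b_coeff scale r1 r2 t = 0"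
    and "t - 1 \<notin> I_set n r1 r2 \<Longrightarrow> c_coeff scale r1 r2 t = 0"
proof -
  assume "t + 1 \<notin> I_set n r1 r2"
  then have "t = int r2 \<or> t = int n - int r1" using assms(3) unfolding I_set_def by auto
  then have "real (b_coeff scale r1 r2 t) = 0" unfolding coeff_formulas(1)[OF assms] by auto
  then show "b_coeff scale r1 r2 t = 0" by simp
next
  assume "t - 1 \<notin> I_set n r1 r2"
  then have "t = 0 \<or> t = int r2 - int r1" using assms(3) unfolding I_set_def by auto
  then have "real (c_coeff scale r1 r2 t) = 0" unfolding coeff_formulas(2)[OF assms] by auto
  then show "c_coeff scale r1 r2 t = 0" by simp
qed

section \<open>The Laplacian acting on kernels\<close>

lemma dim_Int_le_sdist:
  assumes "subspace x" "subspace y" "subspace w"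
  shows "dim (x \<inter> w) \<le> dim (y \<inter> w) + sdist scale x y"
proof -
  \<comment> \<open>\<open>x \<inter> w\<close> and \<open>x \<inter> y\<close> both lie in
    \<open>x\<close>, so their sum has dimension at most \<open>dim x\<close>, while their
    intersection lies in \<open>y \<inter> w\<close>.\<close>
  have "dim (span ((x \<inter> w) \<union> (x \<inter> y))) + dim ((x \<inter> w) \<inter> (x \<inter> y)) = dim (x \<inter> w) + dim (x \<inter> y)"
    using assms by (intro dim_span_Un subspace_inter)
  moreover have "dim (span ((x \<inter> w) \<union> (x \<inter> y))) \<le> dim x"
    using assms by (intro dim_subset span_minimal) auto
  moreover have "dim ((x \<inter> w) \<inter> (x \<inter> y)) \<le> dim (y \<inter> w)" by (intro dim_subset) auto
  ultimately show ?thesis using sdist_plus_dim[of x y] by simp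
qed

text \<open>Exchanging sums leaves, for each \<open>x1\<close>, a sum of kernel differences over the
  neighbours of \<open>x2\<close>. Only neighbours whose distance to \<open>x1\<close> changes
  contribute, and the change is one step up or down.\<close>

lemma has_kernel_op_laplacian:
  assumes k: "has_kernel scale r1 r2 \<Lambda> k"
  shows "has_kernel scale r1 r2 (op_laplacian scale r1 r2 \<Lambda>)
    (\<lambda>t. of_nat (b_coeff scale r1 r2 t) * (k (t + 1) - k t) +
          of_nat (c_coeff scale r1 r2 t) * (k (t - 1) - k t))"
  unfolding has_kernel_def
proof (intro ballI)
  fix \<phi> x2 assume \<phi>: "\<phi> \<in> fspace scale r1" and x2: "x2 \<in> X r2"
  let ?N = "{y \<in> X r2. sdist scale x2 y = 1}"
  let ?d = "\<lambda>y x1. int (sdist scale y x1)"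
  have inner: "(\<Sum>y\<in>?N. k (?d y x1) - k (?d x2 x1)) =
      of_nat (b_coeff scale r1 r2 (?d x2 x1)) * (k (?d x2 x1 + 1) - k (?d x2 x1)) +
      of_nat (c_coeff scale r1 r2 (?d x2 x1)) * (k (?d x2 x1 - 1) - k (?d x2 x1))"
    if x1: "x1 \<in> X r1" for x1
  proof -
    let ?t = "?d x2 x1"
    let ?A = "neighbours_at scale r2 x1 x2 (?t + 1)" and ?C = "neighbours_at scale r2 x1 x2 (?t - 1)"
    have near: "y \<in> ?A \<or> y \<in> ?C \<or> ?d y x1 = ?t" if "y \<in> ?N" for y
    proof -
      have y: "y \<in> X r2" "sdist scale x2 y = 1" "sdist scale y x2 = 1"
        using that sdist_commute[OF x2] by auto
      have "dim (x2 \<inter> x1) \<le> dim (y \<inter> x1) + 1" "dim (y \<inter> x1) \<le> dim (x2 \<inter> x1) + 1"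
        using dim_Int_le_sdist[of x2 y x1] dim_Int_le_sdist[of y x2 x1] y x1 x2 subspaces_dimD by auto
      then have "?d y x1 = ?t + 1 \<or> ?d y x1 = ?t - 1 \<or> ?d y x1 = ?t"
        using sdist_plus_dim[of x2 x1] sdist_plus_dim[of y x1] subspaces_dimD(2)[OF y(1)] subspaces_dimD(2)[OF x2]
        by linarith
      then show ?thesis using y by (auto simp: neighbours_at_def)
    qed
    have sub: "?A \<union> ?C \<subseteq> ?N" using sdist_commute[OF x2] by (auto simp: neighbours_at_def)
    have "(\<Sum>y\<in>?N. k (?d y x1) - k ?t) = (\<Sum>y\<in>?A \<union> ?C. k (?d y x1) - k ?t)"
    proof (intro sum.mono_neutral_right ballI)
      fix y assume "y \<in> ?N - (?A \<union> ?C)"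
      then have "?d y x1 = ?t" using near[of y] by blast
      then show "k (?d y x1) - k ?t = 0" by simp
    qed (use sub in auto)
    also have "\<dots> = (\<Sum>y\<in>?A. k (?d y x1) - k ?t) + (\<Sum>y\<in>?C. k (?d y x1) - k ?t)"
      by (intro sum.union_disjoint) (auto simp: neighbours_at_def)
    also have "(\<Sum>y\<in>?A. k (?d y x1) - k ?t) = (\<Sum>y\<in>?A. k (?t + 1) - k ?t)"
      by (intro sum.cong) (auto simp: neighbours_at_def)
    also have "(\<Sum>y\<in>?C. k (?d y x1) - k ?t) = (\<Sum>y\<in>?C. k (?t - 1) - k ?t)"
      by (intro sum.cong) (auto simp: neighbours_at_def)
    finally show ?thesis using coeff_eq_card[OF x1 x2 refl] by simp
  qed
  have "op_laplacian scale r1 r2 \<Lambda> \<phi> x2 = (\<Sum>y\<in>?N. \<Lambda> \<phi> y - \<Lambda> \<phi> x2)"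
    using x2 by (simp add: op_laplacian_def graph_laplacian_def)
  also have "\<dots> = (\<Sum>y\<in>?N. \<Sum>x1\<in>X r1. (k (?d y x1) - k (?d x2 x1)) * \<phi> x1)"
    using k \<phi> x2 by (intro sum.cong) (auto simp: has_kernel_def sum_subtractf left_diff_distrib)
  also have "\<dots> = (\<Sum>x1\<in>X r1. (\<Sum>y\<in>?N. k (?d y x1) - k (?d x2 x1)) * \<phi> x1)"
    by (subst sum.swap) (simp add: sum_distrib_right)
  also have "\<dots> = (\<Sum>x1\<in>X r1. (of_nat (b_coeff scale r1 r2 (?d x2 x1)) * (k (?d x2 x1 + 1) - k (?d x2 x1)) +
      of_nat (c_coeff scale r1 r2 (?d x2 x1)) * (k (?d x2 x1 - 1) - k (?d x2 x1))) * \<phi> x1)"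
    using inner by (intro sum.cong) auto
  finally show "op_laplacian scale r1 r2 \<Lambda> \<phi> x2 = \<dots>" .
qed

subsection \<open>Transvections\<close>

text \<open>The dimension is read off the cardinality, which an injective map preserves.\<close>

lemma GL_image_subspaces_dim:
  assumes g: "g \<in> GL scale" and x: "x \<in> X r"
  shows "g ` x \<in> X r"
proof -
  interpret g: Vector_Spaces.linear scale scale g using g by (simp add: GL_def)
  have sub: "subspace (g ` x)" using x subspaces_dimD(1) g.subspace_image by blast
  have "card (g ` x) = card x" using g by (auto simp: GL_def bij_def intro: card_image inj_on_subset)
  then have "q ^ dim (g ` x) = q ^ r" using card_subspace[OF sub] card_subspace x subspaces_dimD by metis
  then have "dim (g ` x) = r" using q_ge_2 power_inject_exp[of q] by simp
  then show ?thesis using sub by (simp add: subspaces_dim_def)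
qed

text \<open>Since \<open>f u = 0\<close>, the inverse is \<open>w \<mapsto> w - f(w) u\<close> and
  the square of \<open>h - 1\<close> is zero; \<open>w0\<close> witnesses that \<open>f\<close> is
  nonzero, which makes the range of \<open>h - 1\<close> the whole line through
  \<open>u\<close>.\<close>

lemma transvectionI:
  assumes f: "functional f" "f w0 \<noteq> 0" "f u = 0" and u: "u \<noteq> 0"
  shows "(\<lambda>w. w + scale (f w) u) \<in> transvections scale"
proof -
  interpret f: Vector_Spaces.linear scale "(*)" f by fact
  let ?h = "\<lambda>w. w + scale (f w) u"
  have lin: "Vector_Spaces.linear scale scale ?h"
    unfolding Vector_Spaces.linear_iff
    by (simp add: vector_space_axioms f.add f.scale scale_left_distrib scale_right_distrib algebra_simps)
  have "bij ?h"
    by (rule o_bij[of "\<lambda>w. w - scale (f w) u"]) (auto simp: fun_eq_iff f.add f.diff f.scale f(3))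
  moreover have "scale c u \<in> range (\<lambda>w. scale (f w) u)" for c
    by (rule range_eqI[of _ _ "scale (c / f w0) w0"]) (use f(2) in \<open>simp add: f.scale\<close>)
  then have "range (\<lambda>w. scale (f w) u) = span {u}" by (auto simp: span_singleton)
  then have "dim (range (\<lambda>w. ?h w - w)) = 1" using u by simp
  moreover have "(\<lambda>w. ?h w - w) \<circ> (\<lambda>w. ?h w - w) = (\<lambda>w. 0)" by (simp add: fun_eq_iff f.scale f(3))
  ultimately show ?thesis using lin by (simp add: transvections_def GL_def)
qed

text \<open>The range of \<open>h - 1\<close> is a line, spanned by \<open>u = h u0 - u0\<close>, so
  \<open>h - 1\<close> is \<open>w \<mapsto> f(w) u\<close>. This choice of \<open>u\<close>
  normalizes \<open>f u0 = 1\<close>, and \<open>f u = 0\<close> expresses that the square of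
  \<open>h - 1\<close> vanishes.\<close>

lemma transvectionE:
  assumes h: "h \<in> transvections scale" and u0: "h u0 \<noteq> u0"
  obtains f where "functional f" "f u0 = 1" "f (h u0 - u0) = 0" "\<And>w. h w = w + scale (f w) (h u0 - u0)"
proof -
  interpret h: Vector_Spaces.linear scale scale h using h by (simp add: transvections_def GL_def)
  define u where "u = h u0 - u0"
  let ?R = "range (\<lambda>w. h w - w)"
  have u: "u \<noteq> 0" "u \<in> ?R" using u0 by (auto simp: u_def)
  have "Vector_Spaces.linear scale scale (\<lambda>w. h w - w)"
    unfolding Vector_Spaces.linear_iff by (simp add: vector_space_axioms h.add h.scale scale_right_diff_distrib)
  then have "module_hom scale scale (\<lambda>w. h w - w)" by (simp only: module_hom_iff_linear)
  from module_hom.subspace_image[OF this subspace_UNIV] have R: "subspace ?R" .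
  have "span {u} = ?R"
    using u h by (intro subspace_dim_equal R subspace_span span_minimal) (auto simp: transvections_def)
  then have "\<exists>c. h w - w = scale c u" for w by (auto simp: span_singleton)
  then obtain f where f: "\<And>w. h w - w = scale (f w) u" by metis
  have eqI: "a = b" if "scale a u = scale b u" for a b using that u(1) by simp
  have "functional f"
    unfolding Vector_Spaces.linear_iff
  proof (intro conjI allI)
    show "vector_space scale" by (rule vector_space_axioms)
    show "vector_space ((*) :: 'k \<Rightarrow> 'k \<Rightarrow> 'k)" using dual_pair by (simp add: vector_space_pair_def)
    show "f (a + b) = f a + f b" for a b
      by (rule eqI) (simp add: scale_left_distrib f[symmetric] h.add)
    show "f (scale c a) = c * f a" for c a
      by (rule eqI) (simp add: scale_scale[symmetric] f[symmetric] h.scale scale_right_diff_distrib del: scale_scale)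
  qed
  moreover have "f u0 = 1" by (rule eqI, unfold f[of u0, symmetric], unfold u_def) simp
  moreover have "h u - u = 0" using h by (auto simp: transvections_def fun_eq_iff u_def)
  then have "f u = 0" using f[of u] u by simp
  moreover have "h w = w + scale (f w) u" for w using f[of w] by (simp add: algebra_simps)
  ultimately show thesis using that unfolding u_def by blast
qed

context
  fixes x y r u0
  assumes x: "x \<in> X r" and y: "y \<in> X r" and d: "sdist scale x y = 1" and u0: "u0 \<in> x" "u0 \<notin> y"
begin

lemma dim_Int_neighbours: "dim (x \<inter> y) + 1 = r"
  using sdist_plus_dim[of x y] d x subspaces_dimD by auto

text \<open>A basis of \<open>x \<inter> y\<close> together with \<open>u0\<close> and
  \<open>v\<close> is an independent set of \<open>(r - 1) + 2\<close> vectors, on which the values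
  0, 1 and 1 are prescribed.\<close>

lemma card_normalized_functionals:
  assumes v: "v \<in> y - x"
  shows "card {f \<in> annihilator (x \<inter> y). f u0 = 1 \<and> f v = 1} = q ^ (n - (r + 1))" "r + 1 \<le> n"
proof -
  have s: "subspace x" "subspace y" "dim x = r" "dim y = r" using x y subspaces_dimD by auto
  obtain B where B: "B \<subseteq> x \<inter> y" "independent B" "x \<inter> y \<subseteq> span B" "card B = dim (x \<inter> y)"
    using basis_exists by blast
  have "span B \<subseteq> y" "span (insert u0 B) \<subseteq> x" using B(1) s u0 span_minimal[of B y] span_minimal[of "insert u0 B" x] by auto
  then have notin: "u0 \<notin> span B" "v \<notin> span (insert u0 B)" using u0 v by auto
  have "u0 \<notin> B" "v \<notin> insert u0 B" using notin span_base by blast+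
  then have card: "card (insert v (insert u0 B)) = r + 1" using B(4) dim_Int_neighbours by simp
  have ind: "independent (insert v (insert u0 B))"
    using B(2) notin by (intro independent_insertI)
  show "r + 1 \<le> n" using independent_card_le_dim[OF _ ind, of UNIV] card dim_space by simp
  have "{f \<in> annihilator (x \<inter> y). f u0 = 1 \<and> f v = 1} =
    {f. functional f \<and> (\<forall>b\<in>insert v (insert u0 B). f b = (if b \<in> B then 0 else 1))}"
    using B(1,3) functional_vanish_span \<open>u0 \<notin> B\<close> \<open>v \<notin> insert u0 B\<close>
    unfolding annihilator_def by (auto; metis (full_types) IntI subsetD)
  then show "card {f \<in> annihilator (x \<inter> y). f u0 = 1 \<and> f v = 1} = q ^ (n - (r + 1))"
    using card_functionals_prescribed[OF ind, of "\<lambda>b. if b \<in> B then 0 else 1"] by (simp only: card)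
qed

text \<open>Here \<open>v\<close> is the image of \<open>u0\<close> under the transvection.\<close>

lemma transvections_moving_bij:
  "bij_betw (\<lambda>(v, f) w. w + scale (f w) (v - u0))
     (SIGMA v:y - x. {f \<in> annihilator (x \<inter> y). f u0 = 1 \<and> f v = 1})
     {h \<in> transvections scale. h ` x = y}"
proof (rule bij_betw_imageI)
  have s: "subspace x" "subspace y" "dim x = r" "dim y = r" using x y subspaces_dimD by auto
  let ?S = "SIGMA v:y - x. {f \<in> annihilator (x \<inter> y). f u0 = 1 \<and> f v = 1}"
  let ?\<Phi> = "\<lambda>(v, f) w. w + scale (f w) (v - u0)"
  have "v = v' \<and> f = f'"
    if vf: "(v, f) \<in> ?S" "(v', f') \<in> ?S" and eq: "?\<Phi> (v, f) = ?\<Phi> (v', f')" for v f v' f'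
  proof -
    have "v = v'" using fun_cong[OF eq, of u0] vf by simp
    moreover have "v - u0 \<noteq> 0" using vf u0 by auto
    ultimately have "f w = f' w" for w using fun_cong[OF eq, of w] by simp
    with \<open>v = v'\<close> show ?thesis by auto
  qed
  then show "inj_on ?\<Phi> ?S" by (intro inj_onI) (metis (no_types, lifting) surj_pair)
  show "?\<Phi> ` ?S = {h \<in> transvections scale. h ` x = y}"
  proof (intro equalityI subsetI)
    fix h assume "h \<in> ?\<Phi> ` ?S"
    then obtain v f where vf: "(v, f) \<in> ?S" and h: "h = (\<lambda>w. w + scale (f w) (v - u0))" by auto
    have f: "functional f" "f \<in> annihilator (x \<inter> y)" "f u0 = 1" "f v = 1" and v: "v \<in> y" "v \<notin> x"
      using vf by (auto simp: annihilator_def)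
    interpret f: Vector_Spaces.linear scale "(*)" f by fact
    have T: "h \<in> transvections scale"
      unfolding h using f v u0 by (intro transvectionI[of f u0]) (auto simp: f.diff)
    have "x \<inter> y \<subseteq> x \<inter> {w. f w = 0}" using f(2) by (auto simp: annihilator_def)
    moreover have "dim (x \<inter> {w. f w = 0}) + 1 = r" using dim_kernel_Int[OF f(1) s(1) u0(1)] f(3) s(3) by simp
    ultimately have ker: "x \<inter> y = x \<inter> {w. f w = 0}"
      using dim_Int_neighbours by (intro subspace_dim_equal subspace_inter subspace_kernel s f(1)) auto
    \<comment> \<open>Split off \<open>f(w) u0\<close>: the rest lies in \<open>x \<inter> y\<close>
      and is fixed by \<open>h\<close>, while \<open>h u0 = v\<close>.\<close>
    have "h w \<in> y" if w: "w \<in> x" for w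
    proof -
      have "w - scale (f w) u0 \<in> x \<inter> y"
        unfolding ker using w s(1) u0 f(3) by (auto simp: f.diff f.scale subspace_diff subspace_scale)
      then have "(w - scale (f w) u0) + scale (f w) v \<in> y"
        using v s(2) by (auto intro: subspace_add subspace_scale)
      then show ?thesis by (simp add: h scale_right_diff_distrib algebra_simps)
    qed
    moreover have "card (h ` x) = card y"
    proof -
      have "h ` x \<in> X r" using GL_image_subspaces_dim[OF _ x] T by (simp add: transvections_def)
      then show ?thesis using card_subspace[of "h ` x"] card_subspace[OF s(2)] s(4) subspaces_dimD by simp
    qed
    ultimately have "h ` x = y" by (intro card_subset_eq) auto
    then show "h \<in> {h \<in> transvections scale. h ` x = y}" using T by blast
  next
    fix h assume "h \<in> {h \<in> transvections scale. h ` x = y}"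
    then have T: "h \<in> transvections scale" and hx: "h ` x = y" by auto
    have hu: "h u0 \<in> y" using hx u0 by auto
    then have "h u0 \<noteq> u0" using u0 by auto
    then obtain f where f: "functional f" "f u0 = 1" "f (h u0 - u0) = 0"
      and h: "\<And>w. h w = w + scale (f w) (h u0 - u0)"
      using transvectionE[OF T] by blast
    interpret f: Vector_Spaces.linear scale "(*)" f by fact
    \<comment> \<open>Otherwise \<open>h\<close> maps \<open>x\<close> into itself, so
      \<open>y = x\<close>, which contains \<open>u0\<close>.\<close>
    have "h u0 \<notin> x"
    proof
      assume "h u0 \<in> x"
      then have "h w \<in> x" if "w \<in> x" for w
        unfolding h[of w] using that u0 s(1) by (intro subspace_add subspace_scale subspace_diff) auto
      then have "y \<subseteq> x" using hx by auto
      then have "y = x" using s by (intro subspace_dim_equal) auto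
      then show False using u0 by simp
    qed
    \<comment> \<open>If \<open>f b\<close> were nonzero, dividing \<open>h b - b\<close> by it
      would put \<open>h u0 - u0\<close>, and hence \<open>u0\<close>, into
      \<open>y\<close>.\<close>
    moreover have "f b = 0" if b: "b \<in> x \<inter> y" for b
    proof (rule ccontr)
      assume nz: "f b \<noteq> 0"
      have "h b - b \<in> y" using b hx s(2) by (auto intro: subspace_diff)
      then have "scale (f b) (h u0 - u0) \<in> y" using h[of b] by (metis add_diff_cancel_left')
      then have "scale (1 / f b) (scale (f b) (h u0 - u0)) \<in> y" using s(2) subspace_scale by blast
      then have "h u0 - u0 \<in> y" using nz by simp
      then have "h u0 - (h u0 - u0) \<in> y" using hu s(2) subspace_diff by blast
      then show False using u0 by simp
    qed
    moreover have "f (h u0) = 1" using f by (simp add: f.diff)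
    ultimately have "(h u0, f) \<in> ?S" using f hu by (auto simp: annihilator_def)
    moreover have "h = ?\<Phi> (h u0, f)" by (rule ext, unfold prod.case, rule h)
    ultimately show "h \<in> ?\<Phi> ` ?S" by blast
  qed
qed

end

text \<open>There are \<open>q ^ (r - 1) * (q - 1)\<close> vectors in \<open>y - x\<close> and
  \<open>q ^ (n - (r + 1))\<close> normalized functionals for each; \<open>r\<close> cancels in the
  product. The second conclusion ensures that the exponent \<open>n - 2\<close> is not
  truncated.\<close>

lemma card_transvections_moving:
  assumes x: "x \<in> X r" and y: "y \<in> X r" and d: "sdist scale x y = 1"
  shows "card {h \<in> transvections scale. h ` x = y} = q ^ (n - 2) * (q - 1)" "n \<ge> 2"
proof -
  have s: "subspace x" "subspace y" "dim x = r" "dim y = r" using x y subspaces_dimD by auto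
  have "x \<noteq> y" using d by (auto simp: sdist_def)
  then have "\<not> x \<subseteq> y" using s subspace_dim_equal[of x y] by auto
  then obtain u0 where u0: "u0 \<in> x" "u0 \<notin> y" by auto
  have "\<not> y \<subseteq> x" using \<open>x \<noteq> y\<close> s subspace_dim_equal[of y x] by auto
  then obtain v0 where v0: "v0 \<in> y - x" by auto
  note dI = dim_Int_neighbours[OF x y d u0]
  note cf = card_normalized_functionals[OF x y d u0]
  have "y - x = y - x \<inter> y" by auto
  then have "card (y - x) = card y - card (x \<inter> y)" by (metis card_Diff_subset finite_sets(1) inf_le2)
  also have "\<dots> = q ^ r - q ^ dim (x \<inter> y)"
    using card_subspace[OF s(2)] card_subspace[of "x \<inter> y"] s by (simp add: subspace_inter)
  also have "\<dots> = q ^ r - q ^ (r - 1)" using dI by (metis diff_add_inverse2)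
  also have "\<dots> = q ^ (r - 1) * (q - 1)" using dI by (cases r) (auto simp: algebra_simps)
  finally have cy: "card (y - x) = q ^ (r - 1) * (q - 1)" .
  have "card {h \<in> transvections scale. h ` x = y} =
    card (SIGMA v:y - x. {f \<in> annihilator (x \<inter> y). f u0 = 1 \<and> f v = 1})"
    using bij_betw_same_card[OF transvections_moving_bij[OF x y d u0]] by simp
  also have "\<dots> = (\<Sum>v\<in>y - x. q ^ (n - (r + 1)))" using cf(1) by simp
  also have "\<dots> = q ^ (r - 1) * q ^ (n - (r + 1)) * (q - 1)" using cy by simp
  also have "q ^ (r - 1) * q ^ (n - (r + 1)) = q ^ (n - 2)"
    using cf(2)[OF v0] dI by (simp flip: power_add)
  finally show "card {h \<in> transvections scale. h ` x = y} = q ^ (n - 2) * (q - 1)" .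
  show "n \<ge> 2" using cf(2)[OF v0] dI by simp
qed

text \<open>A transvection fixes the kernel of its functional pointwise, and \<open>x\<close> meets
  that kernel in codimension at most one.\<close>

lemma sdist_transvection_le_1:
  assumes x: "x \<in> X r" and h: "h \<in> transvections scale"
  shows "sdist scale x (h ` x) \<le> 1"
proof -
  have "\<not> range (\<lambda>w. h w - w) \<subseteq> {0}" using h dim_subset[of "range (\<lambda>w. h w - w)" "{0}"]
    by (auto simp: transvections_def)
  then have "\<exists>u0. h u0 - u0 \<noteq> 0" by blast
  then obtain u0 where "h u0 \<noteq> u0" by auto
  then obtain f where f: "functional f" and hf: "\<And>w. h w = w + scale (f w) (h u0 - u0)"
    using transvectionE[OF h] by blast
  have s: "subspace x" using x subspaces_dimD by auto
  have "w \<in> h ` x" if "w \<in> x" "f w = 0" for w using hf[of w] that by force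
  then have "dim (x \<inter> {w. f w = 0}) \<le> dim (x \<inter> h ` x)" by (intro dim_subset) auto
  moreover have "dim x \<le> dim (x \<inter> {w. f w = 0}) + 1"
  proof (cases "f \<in> annihilator x")
    case True
    then show ?thesis using kernel_Int_eq[OF f] by simp
  next
    case False
    then show ?thesis using dim_hyperplane[OF s f] by simp
  qed
  ultimately show ?thesis using sdist_plus_dim[of x "h ` x"] by linarith
qed

lemma sdist_eq_0_iff:
  assumes "x \<in> X r" "y \<in> X r"
  shows "sdist scale x y = 0 \<longleftrightarrow> x = y"
proof
  assume "sdist scale x y = 0"
  then have "x \<inter> y = x"
    using sdist_plus_dim[of x y] assms subspaces_dimD by (intro subspace_dim_equal subspace_inter) auto
  then show "x = y" using assms subspaces_dimD subspace_dim_equal[of x y] by auto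
qed (simp add: sdist_def)

text \<open>Transvections are grouped by the image of \<open>x\<close>: those preserving
  \<open>x\<close> contribute 0, and each neighbour is reached equally often. The integer exponent
  is a natural number as soon as \<open>x\<close> has a neighbour.\<close>

lemma group_laplacian_eq:
  "group_laplacian scale r \<phi> =
    fscale (of_nat q powi (int n - 2) * (of_nat q - 1)) (graph_laplacian scale r \<phi>)"
proof
  fix x
  let ?K = "of_nat q powi (int n - 2) * (of_nat q - 1) :: complex"
  show "group_laplacian scale r \<phi> x = fscale ?K (graph_laplacian scale r \<phi>) x"
  proof (cases "x \<in> X r")
    case x: True
    let ?N = "{y \<in> X r. sdist scale x y = 1}"
    have K: "of_nat (card {h \<in> transvections scale. h ` x = y}) = ?K" if "y \<in> ?N" for y
    proof -
      have y: "y \<in> X r" "sdist scale x y = 1" using that by auto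
      have "int n - 2 = int (n - 2)" using card_transvections_moving(2)[OF x y] by (simp add: of_nat_diff)
      then have "?K = of_nat q ^ (n - 2) * (of_nat q - 1)" by (simp only: power_int_of_nat)
      moreover have "(of_nat (q - 1) :: complex) = of_nat q - 1" using q_ge_2 by (simp add: of_nat_diff)
      ultimately show ?thesis
        using card_transvections_moving(1)[OF x y] by (simp only: of_nat_mult of_nat_power)
    qed
    have "h ` x \<in> insert x ?N" if "h \<in> transvections scale" for h
      using sdist_transvection_le_1[OF x that] GL_image_subspaces_dim[OF _ x, of h] that
        sdist_eq_0_iff[OF x, of "h ` x"] by (auto simp: transvections_def)
    then have "(\<lambda>h. h ` x) ` transvections scale \<subseteq> insert x ?N" by blast
    then have "(\<Sum>h\<in>transvections scale. \<phi> (h ` x) - \<phi> x) =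
      (\<Sum>y\<in>insert x ?N. \<Sum>h\<in>{h \<in> transvections scale. h ` x = y}. \<phi> (h ` x) - \<phi> x)"
      by (intro sum.group[symmetric]) auto
    also have "\<dots> = (\<Sum>y\<in>insert x ?N. of_nat (card {h \<in> transvections scale. h ` x = y}) * (\<phi> y - \<phi> x))"
      by (intro sum.cong refl) simp
    also have "\<dots> = (\<Sum>y\<in>?N. of_nat (card {h \<in> transvections scale. h ` x = y}) * (\<phi> y - \<phi> x))"
      by (intro sum.mono_neutral_right) auto
    also have "\<dots> = (\<Sum>y\<in>?N. ?K * (\<phi> y - \<phi> x))" using K by (intro sum.cong refl) simp
    finally show ?thesis using x
      by (simp add: group_laplacian_def graph_laplacian_def fscale_def sum_distrib_left)
  qed (simp add: group_laplacian_def graph_laplacian_def fscale_def)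
qed

subsection \<open>Laplacians as intertwiners\<close>

lemma fspace_subspace: "module.subspace fscale (fspace scale r)"
proof -
  interpret F: vector_space "fscale :: complex \<Rightarrow> ('v set \<Rightarrow> complex) \<Rightarrow> _" by (rule vector_space_fscale)
  show ?thesis by (rule F.subspaceI) (auto simp: fspace_def fscale_def)
qed

lemma GL_inv:
  assumes "g \<in> GL scale"
  shows "inv g \<in> GL scale"
  using assms unfolding GL_def
  by (auto intro: bij_imp_bij_inv inj_linear_imp_inv_linear dest: bij_is_inj)

lemma image_inv_GL: "g \<in> GL scale \<Longrightarrow> g ` inv g ` x = x" "g \<in> GL scale \<Longrightarrow> inv g ` g ` x = x"
  by (auto simp: GL_def bij_def image_image surj_f_inv_f)

lemma GL_image_subspaces_dim_iff:
  assumes "g \<in> GL scale"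
  shows "g ` x \<in> X r \<longleftrightarrow> x \<in> X r"
  using GL_image_subspaces_dim[OF assms] GL_image_subspaces_dim[OF GL_inv[OF assms]]
    image_inv_GL(2)[OF assms] by metis

lemma sdist_GL_image:
  assumes g: "g \<in> GL scale" and x: "x \<in> X r" and y: "y \<in> X r"
  shows "sdist scale (g ` x) (g ` y) = sdist scale x y"
proof -
  have "subspace (x \<inter> y)" using x y subspaces_dimD(1) by (blast intro: subspace_inter)
  then have "x \<inter> y \<in> X (dim (x \<inter> y))" by (simp add: subspaces_dim_def)
  then have "dim (g ` (x \<inter> y)) = dim (x \<inter> y)" using GL_image_subspaces_dim[OF g] subspaces_dimD(2) by blast
  moreover have "g ` (x \<inter> y) = g ` x \<inter> g ` y" using g by (auto simp: GL_def bij_def intro!: image_Int)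
  ultimately show ?thesis
    unfolding sdist_def using GL_image_subspaces_dim[OF g x] x subspaces_dimD(2) by simp
qed

lemma transvections_GL: "h \<in> transvections scale \<Longrightarrow> h \<in> GL scale"
  by (simp add: transvections_def)

text \<open>Composing with the action of \<open>h\<close> on subspaces is acting by
  \<open>inv h\<close>; outside \<open>X r\<close> both sides vanish because \<open>\<phi>\<close>
  does.\<close>

lemma group_laplacian_rho:
  assumes \<phi>: "\<phi> \<in> fspace scale r"
  shows "group_laplacian scale r \<phi> =
    (\<Sum>h\<in>transvections scale. rho (inv h) \<phi>) - fscale (of_nat (card (transvections scale))) \<phi>"
proof
  fix x
  have r: "rho (inv h) \<phi> x = \<phi> (h ` x)" if "h \<in> transvections scale" for h
    using transvections_GL[OF that] by (simp add: rho_def GL_def inv_inv_eq)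
  show "group_laplacian scale r \<phi> x =
    ((\<Sum>h\<in>transvections scale. rho (inv h) \<phi>) - fscale (of_nat (card (transvections scale))) \<phi>) x"
  proof (cases "x \<in> X r")
    case True
    then show ?thesis by (simp add: group_laplacian_def sum_fun_apply r fscale_def sum_subtractf)
  next
    case False
    then have "\<phi> (h ` x) = 0" if "h \<in> transvections scale" for h
      using GL_image_subspaces_dim_iff[OF transvections_GL[OF that]] \<phi> by (simp add: fspace_def)
    moreover have "\<phi> x = 0" using False \<phi> by (simp add: fspace_def)
    ultimately show ?thesis using False by (simp add: group_laplacian_def sum_fun_apply r fscale_def)
  qed
qed

lemma graph_laplacian_linear:
  "graph_laplacian scale r (\<phi> + \<psi>) = graph_laplacian scale r \<phi> + graph_laplacian scale r \<psi>"
  "graph_laplacian scale r (fscale c \<phi>) = fscale c (graph_laplacian scale r \<phi>)"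
  by (auto simp: graph_laplacian_def fscale_def fun_eq_iff sum.distrib[symmetric] sum_distrib_left
      algebra_simps intro!: sum.cong)

text \<open>Elements of \<open>GL\<close> preserve dimensions and \<open>sdist\<close>, hence are
  automorphisms of the graph.\<close>

lemma graph_laplacian_rho:
  assumes g: "g \<in> GL scale"
  shows "graph_laplacian scale r (rho g \<phi>) = rho g (graph_laplacian scale r \<phi>)"
proof
  fix x
  note g' = GL_inv[OF g]
  show "graph_laplacian scale r (rho g \<phi>) x = rho g (graph_laplacian scale r \<phi>) x"
  proof (cases "x \<in> X r")
    case x: True
    have "bij_betw ((`) (inv g)) {y \<in> X r. sdist scale x y = 1} {y \<in> X r. sdist scale (inv g ` x) y = 1}"
    proof (rule bij_betw_byWitness[where f' = "(`) g"])
      show "(`) (inv g) ` {y \<in> X r. sdist scale x y = 1} \<subseteq> {y \<in> X r. sdist scale (inv g ` x) y = 1}"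
        using sdist_GL_image[OF g' x] GL_image_subspaces_dim[OF g'] by auto
      show "(`) g ` {y \<in> X r. sdist scale (inv g ` x) y = 1} \<subseteq> {y \<in> X r. sdist scale x y = 1}"
        using sdist_GL_image[OF g GL_image_subspaces_dim[OF g' x]] GL_image_subspaces_dim[OF g]
        by (auto simp: image_inv_GL(1)[OF g])
    qed (simp_all add: image_inv_GL[OF g])
    then have "(\<Sum>y\<in>{y \<in> X r. sdist scale (inv g ` x) y = 1}. \<phi> y - \<phi> (inv g ` x)) =
        (\<Sum>y\<in>{y \<in> X r. sdist scale x y = 1}. \<phi> (inv g ` y) - \<phi> (inv g ` x))"
      by (rule sum.reindex_bij_betw[symmetric])
    then show ?thesis using x GL_image_subspaces_dim[OF g' x] by (simp add: graph_laplacian_def rho_def)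
  next
    case False
    then show ?thesis using GL_image_subspaces_dim_iff[OF g'] by (simp add: graph_laplacian_def rho_def)
  qed
qed

text \<open>The factor between the two Laplacians; being nonzero, it can be divided out.\<close>

definition degree_ratio :: complex where
  "degree_ratio = of_nat q powi (int n - 2) * (of_nat q - 1)"

lemma degree_ratio_nonzero: "degree_ratio \<noteq> 0"
proof -
  have "of_nat q \<noteq> (1 :: complex)" using q_ge_2 by (metis of_nat_1 of_nat_eq_iff numeral_le_one_iff semiring_norm(69))
  then show ?thesis using q_ge_2 by (simp add: degree_ratio_def)
qed

lemma graph_laplacian_eq: "graph_laplacian scale r \<phi> = fscale (1 / degree_ratio) (group_laplacian scale r \<phi>)"
  unfolding group_laplacian_eq using degree_ratio_nonzero by (simp add: fscale_def fun_eq_iff flip: degree_ratio_def)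

text \<open>The group Laplacian is the action of an element of the group algebra, so it makes sense in
  every representation and every intertwiner commutes with it.\<close>

lemma intertwiner_group_laplacian:
  assumes rep: "is_rep scale fscale W rho" and W: "W \<subseteq> fspace scale r" and vs: "vector_space s2"
    and f: "equivariant_between scale fscale W rho s2 W2 p2 f" and \<phi>: "\<phi> \<in> W"
  shows "group_laplacian scale r \<phi> \<in> W"
    and "f (group_laplacian scale r \<phi>) =
      (\<Sum>h\<in>transvections scale. p2 (inv h) (f \<phi>)) - s2 (of_nat (card (transvections scale))) (f \<phi>)"
proof -
  interpret F: vector_space "fscale :: complex \<Rightarrow> ('v set \<Rightarrow> complex) \<Rightarrow> _" by (rule vector_space_fscale)
  interpret V2: vector_space s2 by fact
  let ?T = "transvections scale" and ?c = "of_nat (card (transvections scale)) :: complex"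
  have sub: "module.subspace fscale W" using rep by (simp add: is_rep_def)
  have lin: "linear_between fscale W s2 W2 f" using f by (simp add: equivariant_between_def)
  have inv: "inv h \<in> GL scale" if "h \<in> ?T" for h using GL_inv transvections_GL that by blast
  have r: "rho (inv h) \<phi> \<in> W" if "h \<in> ?T" for h
    using rep inv[OF that] \<phi> by (simp add: is_rep_def linear_between_def)
  have sum: "(\<Sum>h\<in>?T. rho (inv h) \<phi>) \<in> W" using r by (rule F.subspace_sum[OF sub])
  have eq: "group_laplacian scale r \<phi> = (\<Sum>h\<in>?T. rho (inv h) \<phi>) + fscale (- ?c) \<phi>"
    using group_laplacian_rho W \<phi> by (auto simp: F.scale_minus_left)
  have c: "fscale (- ?c) \<phi> \<in> W" using \<phi> by (rule F.subspace_scale[OF sub])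
  show "group_laplacian scale r \<phi> \<in> W" unfolding eq using sum c by (rule F.subspace_add[OF sub])
  have "f (group_laplacian scale r \<phi>) = f (\<Sum>h\<in>?T. rho (inv h) \<phi>) + f (fscale (- ?c) \<phi>)"
    unfolding eq using lin sum c unfolding linear_between_def by blast
  also have "f (fscale (- ?c) \<phi>) = s2 (- ?c) (f \<phi>)" using lin \<phi> unfolding linear_between_def by blast
  also have "f (\<Sum>h\<in>?T. rho (inv h) \<phi>) = (\<Sum>h\<in>?T. f (rho (inv h) \<phi>))"
    by (rule linear_between_sum[OF vector_space_fscale vs sub lin r])
  also have "\<dots> = (\<Sum>h\<in>?T. p2 (inv h) (f \<phi>))"
    using f \<phi> inv by (intro sum.cong refl) (simp add: equivariant_between_def)
  finally show "f (group_laplacian scale r \<phi>) = (\<Sum>h\<in>?T. p2 (inv h) (f \<phi>)) - s2 ?c (f \<phi>)"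
    by (simp add: V2.scale_minus_left)
qed

lemma is_rep_fspace: "is_rep scale fscale (fspace scale r) rho"
proof -
  have "linear_between fscale (fspace scale r) fscale (fspace scale r) (rho g)" if g: "g \<in> GL scale" for g
    using GL_image_subspaces_dim_iff[OF GL_inv[OF g]]
    by (auto simp: linear_between_def fspace_def rho_def fscale_def fun_eq_iff)
  moreover have "rho (g \<circ> h) w = rho g (rho h w)" if "g \<in> GL scale" "h \<in> GL scale" for g h w
    using that by (simp add: rho_def fun_eq_iff o_inv_distrib GL_def image_comp)
  moreover have "rho id w = w" for w :: "'v set \<Rightarrow> complex" by (simp add: rho_def)
  ultimately show ?thesis
    by (simp add: is_rep_def vector_space_fscale fspace_subspace)
qed

text \<open>\<open>\<Lambda>\<close> commutes with the group Laplacian, and dividing by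
  \<open>degree_ratio\<close> passes to the graph Laplacian.\<close>

lemma equivariant_graph_laplacian:
  assumes \<Lambda>: "equivariant scale (fspace scale r1) (fspace scale r2) \<Lambda>" and \<phi>: "\<phi> \<in> fspace scale r1"
  shows "graph_laplacian scale r2 (\<Lambda> \<phi>) = \<Lambda> (graph_laplacian scale r1 \<phi>)"
proof -
  note * = intertwiner_group_laplacian[OF is_rep_fspace subset_refl vector_space_fscale \<Lambda> \<phi>]
  have lin: "linear_between fscale (fspace scale r1) fscale (fspace scale r2) \<Lambda>"
    using \<Lambda> by (simp add: equivariant_between_def)
  then have "\<Lambda> \<phi> \<in> fspace scale r2" using \<phi> by (simp add: linear_between_def)
  then have "group_laplacian scale r2 (\<Lambda> \<phi>) = \<Lambda> (group_laplacian scale r1 \<phi>)"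
    using *(2) group_laplacian_rho by simp
  then show ?thesis using lin *(1) by (simp add: graph_laplacian_eq linear_between_def)
qed

section \<open>Schur's lemma and the common eigenvalues\<close>

lemma Schur_graph_laplacian:
  assumes irr: "irreducible_rep scale fscale V rho" and V: "V \<subseteq> fspace scale r"
  obtains a where "\<And>\<phi>. \<phi> \<in> V \<Longrightarrow> graph_laplacian scale r \<phi> = fscale a \<phi>"
proof -
  interpret F: vector_space "fscale :: complex \<Rightarrow> ('v set \<Rightarrow> complex) \<Rightarrow> _" by (rule vector_space_fscale)
  have rep: "is_rep scale fscale V rho" using irr by (simp add: irreducible_rep_def)
  then have sub: "module.subspace fscale V" by (simp add: is_rep_def)
  \<comment> \<open>The identity serves as the intertwiner, to obtain that \<open>V\<close> is
    stable under the group Laplacian.\<close>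
  have "equivariant_between scale fscale V rho fscale V rho (\<lambda>\<phi>. \<phi>)"
    by (simp add: equivariant_between_def linear_between_def)
  then have "group_laplacian scale r \<phi> \<in> V" if "\<phi> \<in> V" for \<phi>
    using intertwiner_group_laplacian(1)[OF rep V vector_space_fscale _ that] by blast
  then have stable: "graph_laplacian scale r \<phi> \<in> V" if "\<phi> \<in> V" for \<phi>
    using that by (simp add: graph_laplacian_eq F.subspace_scale[OF sub])
  obtain \<phi> where "\<phi> \<in> V" "\<phi> \<noteq> 0"
    using irr F.subspace_0[OF sub] by (auto simp: irreducible_rep_def)
  then obtain a \<psi> where \<psi>: "\<psi> \<in> V" "\<psi> \<noteq> 0" "graph_laplacian scale r \<psi> = fscale a \<psi>"
    using eigenvector_exists[OF _ graph_laplacian_linear sub stable] by (metis finite_sets(2))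
  \<comment> \<open>The eigenspace for \<open>a\<close> inside \<open>V\<close> is invariant,
    because the Laplacian commutes with \<open>rho\<close>, and it contains \<open>\<psi>\<close>;
    irreducibility makes it all of \<open>V\<close>.\<close>
  let ?U = "{\<phi> \<in> V. graph_laplacian scale r \<phi> = fscale a \<phi>}"
  have "graph_laplacian scale r 0 = 0" by (auto simp: graph_laplacian_def)
  then have "module.subspace fscale ?U"
    by (intro F.subspaceI) (auto simp: graph_laplacian_linear F.scale_right_distrib F.subspace_0[OF sub]
        F.subspace_add[OF sub] F.subspace_scale[OF sub] mult.commute)
  moreover have "rho g \<phi> \<in> ?U" if g: "g \<in> GL scale" and \<phi>: "\<phi> \<in> ?U" for g \<phi>
  proof -
    have "rho g (fscale a \<phi>) = fscale a (rho g \<phi>)" by (simp add: rho_def fscale_def)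
    moreover have "rho g \<phi> \<in> V" using rep g \<phi> by (simp add: is_rep_def linear_between_def)
    ultimately show ?thesis using \<phi> graph_laplacian_rho[OF g] by simp
  qed
  ultimately have "?U = {0} \<or> ?U = V"
    using irr unfolding irreducible_rep_def by blast
  then have "?U = V" using \<psi> by auto
  then show thesis using that by blast
qed

text \<open>The equivalence carries the eigenvalue to \<open>W\<close>, where the same group algebra
  element acts by a scalar; that side no longer refers to \<open>r\<close>.\<close>

lemma eigenvalue_transfer:
  assumes irr: "irreducible_rep scale fscale V rho" and V: "V \<subseteq> fspace scale r"
    and eq: "equivalent_reps scale fscale V rho sc W p" and W: "irreducible_rep scale sc W p"
  obtains a where "\<And>\<phi>. \<phi> \<in> V \<Longrightarrow> graph_laplacian scale r \<phi> = fscale a \<phi>"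
    and "\<And>w. w \<in> W \<Longrightarrow> (\<Sum>h\<in>transvections scale. p (inv h) w) - sc (of_nat (card (transvections scale))) w =
      sc (degree_ratio * a) w"
proof -
  have rep: "is_rep scale fscale V rho" and vs: "vector_space sc"
    using irr W by (simp_all add: irreducible_rep_def is_rep_def)
  obtain a where a: "\<And>\<phi>. \<phi> \<in> V \<Longrightarrow> graph_laplacian scale r \<phi> = fscale a \<phi>"
    using Schur_graph_laplacian[OF irr V] by blast
  obtain f where f: "equivariant_between scale fscale V rho sc W p f" "bij_betw f V W"
    using eq by (auto simp: equivalent_reps_def)
  have "(\<Sum>h\<in>transvections scale. p (inv h) w) - sc (of_nat (card (transvections scale))) w =
      sc (degree_ratio * a) w" if "w \<in> W" for w
  proof -
    obtain \<phi> where \<phi>: "\<phi> \<in> V" "w = f \<phi>" using f(2) \<open>w \<in> W\<close> by (auto simp: bij_betw_def)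
    have "group_laplacian scale r \<phi> = fscale (degree_ratio * a) \<phi>"
      unfolding group_laplacian_eq degree_ratio_def[symmetric] a[OF \<phi>(1)]
      by (simp add: fscale_def mult.assoc)
    then have "f (group_laplacian scale r \<phi>) = sc (degree_ratio * a) w"
      using f(1) \<phi> by (simp add: equivariant_between_def linear_between_def)
    then show ?thesis using intertwiner_group_laplacian(2)[OF rep V vs f(1) \<phi>(1)] \<phi>(2) by simp
  qed
  then show thesis using that a by blast
qed

lemma irreducible_decompositionD:
  assumes "irreducible_decomposition scale n sc W p Vs" "r \<le> n" "s \<le> min r (n - r)"
  shows "Vs r s \<subseteq> fspace scale r" "irreducible_rep scale fscale (Vs r s) rho"
    "equivalent_reps scale fscale (Vs r s) rho sc (W s) (p s)"
  using assms unfolding irreducible_decomposition_def by blast+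

text \<open>For fixed \<open>s\<close>, every \<open>Vs r s\<close> yields the scalar by which
  \<open>D s\<close> acts on \<open>W s\<close>. As \<open>W s\<close> and
  \<open>degree_ratio\<close> are nonzero, that scalar determines the eigenvalue, which therefore is
  the same for all \<open>r\<close>.\<close>

lemma decomposition_eigenvalues:
  assumes dec: "irreducible_decomposition scale n sc W p Vs"
  obtains \<mu> where "\<And>r s \<phi>. r \<le> n \<Longrightarrow> s \<le> min r (n - r) \<Longrightarrow> \<phi> \<in> Vs r s \<Longrightarrow>
    graph_laplacian scale r \<phi> + fscale (\<mu> s) \<phi> = 0"
proof -
  define D where "D s w = (\<Sum>h\<in>transvections scale. p s (inv h) w) - sc (of_nat (card (transvections scale))) w"
    for s w
  have key: "\<exists>a. (\<forall>\<phi>\<in>Vs r s. graph_laplacian scale r \<phi> = fscale a \<phi>) \<and> (\<forall>w\<in>W s. D s w = sc (degree_ratio * a) w)"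
    if "r \<le> n" "s \<le> min r (n - r)" for r s
  proof -
    have "s \<le> n div 2" using that by auto
    then have W: "irreducible_rep scale sc (W s) (p s)" using dec by (simp add: irreducible_decomposition_def)
    note V = irreducible_decompositionD[OF dec that]
    show ?thesis using eigenvalue_transfer[OF V(2,1,3) W] unfolding D_def by metis
  qed
  \<comment> \<open>For \<open>s \<le> n div 2\<close> the space \<open>Vs s s\<close> always
    occurs, so it can supply the scalar on \<open>W s\<close>.\<close>
  then have "\<exists>a. \<forall>w\<in>W s. D s w = sc (degree_ratio * a) w" if "s \<le> n div 2" for s
  proof -
    have "s \<le> n" "s \<le> min s (n - s)" using that by auto
    then show ?thesis using key[of s s] by blast
  qed
  then obtain a where a: "\<And>s w. s \<le> n div 2 \<Longrightarrow> w \<in> W s \<Longrightarrow> D s w = sc (degree_ratio * a s) w"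
    by metis
  have "graph_laplacian scale r \<phi> + fscale (- a s) \<phi> = 0"
    if rs: "r \<le> n" "s \<le> min r (n - r)" and \<phi>: "\<phi> \<in> Vs r s" for r s \<phi>
  proof -
    have s: "s \<le> n div 2" using rs by auto
    then have W: "irreducible_rep scale sc (W s) (p s)" using dec by (simp add: irreducible_decomposition_def)
    then interpret S: vector_space sc by (simp add: irreducible_rep_def is_rep_def)
    obtain w where w: "w \<in> W s" "w \<noteq> 0"
      using W S.subspace_0 by (auto simp: irreducible_rep_def is_rep_def)
    obtain b where b: "graph_laplacian scale r \<phi> = fscale b \<phi>" "D s w = sc (degree_ratio * b) w"
      using key[OF rs] \<phi> w(1) by blast
    then have "b = a s" using a[OF s w(1)] w(2) degree_ratio_nonzero by auto
    then show ?thesis using b(1) by (simp add: fscale_def fun_eq_iff)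
  qed
  then show thesis by (rule that[of "\<lambda>s. - a s"])
qed

text \<open>Prepares for operators vanishing on the orthogonal complement of \<open>Vs r s\<close>:
  \<open>\<psi>\<close> collects the components with index other than \<open>s\<close>, each
  orthogonal to \<open>Vs r s\<close>.\<close>

lemma component_of_orthogonal_decomposition:
  assumes dec: "irreducible_decomposition scale n sc W p Vs" and rs: "r \<le> n" "s \<le> min r (n - r)"
    and \<phi>: "\<phi> \<in> fspace scale r"
  obtains \<phi>' \<psi> where "\<phi>' \<in> Vs r s" "\<psi> \<in> fspace scale r" "\<forall>\<chi>\<in>Vs r s. finner scale r \<psi> \<chi> = 0" "\<phi> = \<phi>' + \<psi>"
proof -
  interpret F: vector_space "fscale :: complex \<Rightarrow> ('v set \<Rightarrow> complex) \<Rightarrow> _" by (rule vector_space_fscale)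
  let ?S = "{..min r (n - r)}"
  have "fspace scale r = {\<Sum>s\<le>min r (n - r). f s | f. \<forall>s\<le>min r (n - r). f s \<in> Vs r s}"
    using dec rs(1) unfolding irreducible_decomposition_def by blast
  then obtain f where f: "\<phi> = (\<Sum>s\<in>?S. f s)" "\<And>s. s \<in> ?S \<Longrightarrow> f s \<in> Vs r s" using \<phi> by auto
  have sub: "Vs r s' \<subseteq> fspace scale r" if "s' \<in> ?S" for s'
    using irreducible_decompositionD(1)[OF dec rs(1)] that by simp
  have orth: "finner scale r (f s') \<chi> = 0" if "s' \<in> ?S - {s}" "\<chi> \<in> Vs r s" for s' \<chi>
  proof -
    have "s' \<le> min r (n - r)" "s' \<noteq> s" "f s' \<in> Vs r s'" using that f(2) by auto
    then show ?thesis using dec rs that(2) unfolding irreducible_decomposition_def by blast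
  qed
  let ?\<psi> = "\<Sum>s'\<in>?S - {s}. f s'"
  have "\<phi> = f s + ?\<psi>" unfolding f(1) using rs(2) by (subst sum.remove[of _ s]) auto
  moreover have "?\<psi> \<in> fspace scale r"
    using f(2) sub by (intro F.subspace_sum[OF fspace_subspace]) blast
  moreover have "finner scale r ?\<psi> \<chi> = 0" if "\<chi> \<in> Vs r s" for \<chi>
  proof -
    have "finner scale r ?\<psi> \<chi> = (\<Sum>s'\<in>?S - {s}. finner scale r (f s') \<chi>)"
      unfolding finner_def sum_fun_apply sum_distrib_right by (rule sum.swap)
    then show ?thesis using orth[OF _ that] by simp
  qed
  moreover have "f s \<in> Vs r s" using f(2) rs(2) by simp
  ultimately show thesis using that by blast
qed

text \<open>Only the component of \<open>\<phi>\<close> in \<open>Vs r1 s\<close> survives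
  \<open>\<Lambda>\<close>, and its image lies in \<open>Vs r2 s\<close>, where the Laplacian is the
  scalar \<open>- \<mu>\<close>.\<close>

lemma op_laplacian_eigenvalue:
  assumes dec: "irreducible_decomposition scale n sc W p Vs" and r: "r1 \<le> n" "r2 \<le> n" and s: "s \<le> N_min n r1 r2"
    and \<mu>: "\<And>\<phi>. \<phi> \<in> Vs r2 s \<Longrightarrow> graph_laplacian scale r2 \<phi> + fscale \<mu> \<phi> = 0"
    and lin: "linear_between fscale (fspace scale r1) fscale (fspace scale r2) \<Lambda>"
    and eqv: "equivariant scale (Vs r1 s) (Vs r2 s) \<Lambda>"
    and orth: "\<And>\<phi>. \<phi> \<in> fspace scale r1 \<Longrightarrow> \<forall>\<psi>\<in>Vs r1 s. finner scale r1 \<phi> \<psi> = 0 \<Longrightarrow> \<Lambda> \<phi> = 0"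
    and \<phi>: "\<phi> \<in> fspace scale r1"
  shows "op_laplacian scale r1 r2 \<Lambda> \<phi> + fscale \<mu> (\<Lambda> \<phi>) = 0"
proof -
  have s1: "s \<le> min r1 (n - r1)" using s by (simp add: N_min_def)
  obtain \<phi>' \<psi> where d: "\<phi>' \<in> Vs r1 s" "\<psi> \<in> fspace scale r1" "\<forall>\<chi>\<in>Vs r1 s. finner scale r1 \<psi> \<chi> = 0" "\<phi> = \<phi>' + \<psi>"
    using component_of_orthogonal_decomposition[OF dec r(1) s1 \<phi>] by blast
  have "\<phi>' \<in> fspace scale r1" using irreducible_decompositionD(1)[OF dec r(1) s1] d(1) by blast
  then have "\<Lambda> \<phi> = \<Lambda> \<phi>' + \<Lambda> \<psi>" using lin d(2,4) by (simp add: linear_between_def)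
  then have "\<Lambda> \<phi> = \<Lambda> \<phi>'" using orth[OF d(2,3)] by simp
  then have "\<Lambda> \<phi> \<in> Vs r2 s" using eqv d(1) by (simp add: equivariant_between_def linear_between_def)
  then show ?thesis using \<mu> by (simp add: op_laplacian_def)
qed

end

theorem theorem2p3:
  fixes scale :: "'k::{field, finite} \<Rightarrow> 'v::ab_group_add \<Rightarrow> 'v"
    and Basis :: "'v set"
    and q n :: nat
    and sc :: "complex \<Rightarrow> 'a::ab_group_add \<Rightarrow> 'a"
    and W :: "nat \<Rightarrow> 'a set"
    and p :: "nat \<Rightarrow> ('v \<Rightarrow> 'v) \<Rightarrow> 'a \<Rightarrow> 'a"
    and Vs :: "nat \<Rightarrow> nat \<Rightarrow> ('v set \<Rightarrow> complex) set"
  assumes fin_dim: "finite_dimensional_vector_space scale Basis"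
    and q: "card (UNIV :: 'k set) = q"
    and n: "vector_space.dim scale (UNIV :: 'v set) = n"
  shows
    "\<comment> \<open>(a)\<close>
     (\<forall>r\<le>n.
        (\<forall>x\<in>subspaces_dim scale r. \<forall>y\<in>subspaces_dim scale r. sdist scale x y = 1 \<longrightarrow>
           real (card {h \<in> transvections scale. h ` x = y}) = real q powi (int n - 2) * (real q - 1)) \<and>
        (\<forall>\<phi>\<in>fspace scale r.
           group_laplacian scale r \<phi> =
           fscale (of_nat q powi (int n - 2) * (of_nat q - 1)) (graph_laplacian scale r \<phi>))) \<and>
     \<comment> \<open>(b)\<close>
     (\<forall>r1\<le>n. \<forall>r2\<le>n. \<forall>\<Lambda>. equivariant scale (fspace scale r1) (fspace scale r2) \<Lambda> \<longrightarrow>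
        (\<forall>\<phi>\<in>fspace scale r1.
           graph_laplacian scale r2 (\<Lambda> \<phi>) = op_laplacian scale r1 r2 \<Lambda> \<phi> \<and>
           op_laplacian scale r1 r2 \<Lambda> \<phi> = \<Lambda> (graph_laplacian scale r1 \<phi>))) \<and>
     \<comment> \<open>(c)\<close>
     (irreducible_decomposition scale n sc W p Vs \<longrightarrow>
        (\<exists>\<mu> :: nat \<Rightarrow> complex.
          (\<forall>s. \<forall>r\<le>n. s \<le> min r (n - r) \<longrightarrow>
             (\<forall>\<phi>\<in>Vs r s. graph_laplacian scale r \<phi> + fscale (\<mu> s) \<phi> = 0)) \<and>
          (\<forall>r1\<le>n. \<forall>r2\<le>n. \<forall>s\<le>N_min n r1 r2. \<forall>\<Lambda>.
             linear_between fscale (fspace scale r1) fscale (fspace scale r2) \<Lambda> \<and>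
             equivariant scale (Vs r1 s) (Vs r2 s) \<Lambda> \<and>
             (\<forall>\<phi>\<in>fspace scale r1. (\<forall>\<psi>\<in>Vs r1 s. finner scale r1 \<phi> \<psi> = 0) \<longrightarrow> \<Lambda> \<phi> = 0) \<longrightarrow>
             (\<forall>\<phi>\<in>fspace scale r1. op_laplacian scale r1 r2 \<Lambda> \<phi> + fscale (\<mu> s) (\<Lambda> \<phi>) = 0)))) \<and>
     \<comment> \<open>(d)\<close>
     (\<forall>r1\<le>n. \<forall>r2\<le>n.
        (\<forall>t\<in>I_set n r1 r2. \<forall>x1\<in>subspaces_dim scale r1. \<forall>x2\<in>subspaces_dim scale r2.
           int (sdist scale x2 x1) = t \<longrightarrow>
           b_coeff scale r1 r2 t = card (neighbours_at scale r2 x1 x2 (t + 1)) \<and>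
           c_coeff scale r1 r2 t = card (neighbours_at scale r2 x1 x2 (t - 1))) \<and>
        (\<forall>t\<in>I_set n r1 r2.
           (t + 1 \<notin> I_set n r1 r2 \<longrightarrow> b_coeff scale r1 r2 t = 0) \<and>
           (t - 1 \<notin> I_set n r1 r2 \<longrightarrow> c_coeff scale r1 r2 t = 0)) \<and>
        (\<forall>\<Lambda> k. equivariant scale (fspace scale r1) (fspace scale r2) \<Lambda> \<and>
                has_kernel scale r1 r2 \<Lambda> k \<longrightarrow>
           has_kernel scale r1 r2 (op_laplacian scale r1 r2 \<Lambda>)
             (\<lambda>t. of_nat (b_coeff scale r1 r2 t) * (k (t + 1) - k t) +
                   of_nat (c_coeff scale r1 r2 t) * (k (t - 1) - k t)))) \<and>
     \<comment> \<open>(e)\<close>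
     (\<forall>r1\<le>n. \<forall>r2\<le>n. \<forall>t\<in>I_set n r1 r2.
        real (b_coeff scale r1 r2 t) =
          real q powi (int r1 - int r2 + 1) * (real q powi t - real q ^ r2) *
          (real q powi t - real q powi (int n - int r1)) / (real q - 1)\<^sup>2 \<and>
        real (c_coeff scale r1 r2 t) =
          real q powi (int r1 - int r2) * (real q powi t - 1) *
          (real q powi t - real q powi (int r2 - int r1)) / (real q - 1)\<^sup>2)"
proof -
  interpret finite_field_space scale Basis q n
    using fin_dim q n by (simp add: finite_field_space_def finite_field_space_axioms_def)
  show ?thesis
  proof (intro conjI)
    show "\<forall>r\<le>n.
        (\<forall>x\<in>subspaces_dim scale r. \<forall>y\<in>subspaces_dim scale r. sdist scale x y = 1 \<longrightarrow>
           real (card {h \<in> transvections scale. h ` x = y}) = real q powi (int n - 2) * (real q - 1)) \<and>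
        (\<forall>\<phi>\<in>fspace scale r.
           group_laplacian scale r \<phi> =
           fscale (of_nat q powi (int n - 2) * (of_nat q - 1)) (graph_laplacian scale r \<phi>))"
    proof (intro allI impI conjI ballI)
      fix r x y assume xy: "x \<in> subspaces_dim scale r" "y \<in> subspaces_dim scale r" "sdist scale x y = 1"
      \<comment> \<open>The pair at distance one forces \<open>n \<ge> 2\<close>, so the integer
        exponent agrees with the truncated one.\<close>
      have "int n - 2 = int (n - 2)" using card_transvections_moving(2)[OF xy] by (simp add: of_nat_diff)
      then have "real q powi (int n - 2) = real q ^ (n - 2)" by (simp only: power_int_of_nat)
      moreover have "real (q - 1) = real q - 1" using q_ge_2 by (simp add: of_nat_diff)
      ultimately show "real (card {h \<in> transvections scale. h ` x = y}) = real q powi (int n - 2) * (real q - 1)"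
        using card_transvections_moving(1)[OF xy] by (simp only: of_nat_mult of_nat_power)
    qed (rule group_laplacian_eq)
    show "\<forall>r1\<le>n. \<forall>r2\<le>n. \<forall>\<Lambda>. equivariant scale (fspace scale r1) (fspace scale r2) \<Lambda> \<longrightarrow>
        (\<forall>\<phi>\<in>fspace scale r1.
           graph_laplacian scale r2 (\<Lambda> \<phi>) = op_laplacian scale r1 r2 \<Lambda> \<phi> \<and>
           op_laplacian scale r1 r2 \<Lambda> \<phi> = \<Lambda> (graph_laplacian scale r1 \<phi>))"
      using equivariant_graph_laplacian unfolding op_laplacian_def o_apply by blast
    show "irreducible_decomposition scale n sc W p Vs \<longrightarrow>
        (\<exists>\<mu> :: nat \<Rightarrow> complex.
          (\<forall>s. \<forall>r\<le>n. s \<le> min r (n - r) \<longrightarrow>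
             (\<forall>\<phi>\<in>Vs r s. graph_laplacian scale r \<phi> + fscale (\<mu> s) \<phi> = 0)) \<and>
          (\<forall>r1\<le>n. \<forall>r2\<le>n. \<forall>s\<le>N_min n r1 r2. \<forall>\<Lambda>.
             linear_between fscale (fspace scale r1) fscale (fspace scale r2) \<Lambda> \<and>
             equivariant scale (Vs r1 s) (Vs r2 s) \<Lambda> \<and>
             (\<forall>\<phi>\<in>fspace scale r1. (\<forall>\<psi>\<in>Vs r1 s. finner scale r1 \<phi> \<psi> = 0) \<longrightarrow> \<Lambda> \<phi> = 0) \<longrightarrow>
             (\<forall>\<phi>\<in>fspace scale r1. op_laplacian scale r1 r2 \<Lambda> \<phi> + fscale (\<mu> s) (\<Lambda> \<phi>) = 0)))"
    proof
      assume dec: "irreducible_decomposition scale n sc W p Vs"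
      obtain \<mu> where \<mu>: "\<And>r s \<phi>. r \<le> n \<Longrightarrow> s \<le> min r (n - r) \<Longrightarrow> \<phi> \<in> Vs r s \<Longrightarrow>
          graph_laplacian scale r \<phi> + fscale (\<mu> s) \<phi> = 0"
        using decomposition_eigenvalues[OF dec] by blast
      have op: "op_laplacian scale r1 r2 \<Lambda> \<phi> + fscale (\<mu> s) (\<Lambda> \<phi>) = 0"
        if r: "r1 \<le> n" "r2 \<le> n" and s: "s \<le> N_min n r1 r2"
          and lin: "linear_between fscale (fspace scale r1) fscale (fspace scale r2) \<Lambda>"
          and eqv: "equivariant scale (Vs r1 s) (Vs r2 s) \<Lambda>"
          and orth: "\<forall>\<phi>\<in>fspace scale r1. (\<forall>\<psi>\<in>Vs r1 s. finner scale r1 \<phi> \<psi> = 0) \<longrightarrow> \<Lambda> \<phi> = 0"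
          and \<phi>: "\<phi> \<in> fspace scale r1" for r1 r2 s \<Lambda> \<phi>
      proof -
        have "s \<le> min r2 (n - r2)" using s by (simp add: N_min_def)
        then show ?thesis
          using \<mu>[OF r(2)] orth by (intro op_laplacian_eigenvalue[OF dec r s _ lin eqv _ \<phi>]) blast+
      qed
      show "\<exists>\<mu> :: nat \<Rightarrow> complex.
          (\<forall>s. \<forall>r\<le>n. s \<le> min r (n - r) \<longrightarrow>
             (\<forall>\<phi>\<in>Vs r s. graph_laplacian scale r \<phi> + fscale (\<mu> s) \<phi> = 0)) \<and>
          (\<forall>r1\<le>n. \<forall>r2\<le>n. \<forall>s\<le>N_min n r1 r2. \<forall>\<Lambda>.
             linear_between fscale (fspace scale r1) fscale (fspace scale r2) \<Lambda> \<and>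
             equivariant scale (Vs r1 s) (Vs r2 s) \<Lambda> \<and>
             (\<forall>\<phi>\<in>fspace scale r1. (\<forall>\<psi>\<in>Vs r1 s. finner scale r1 \<phi> \<psi> = 0) \<longrightarrow> \<Lambda> \<phi> = 0) \<longrightarrow>
             (\<forall>\<phi>\<in>fspace scale r1. op_laplacian scale r1 r2 \<Lambda> \<phi> + fscale (\<mu> s) (\<Lambda> \<phi>) = 0))"
        by (intro exI[of _ \<mu>] conjI allI impI ballI; (elim conjE)?; rule \<mu> op; assumption)
    qed
    show "\<forall>r1\<le>n. \<forall>r2\<le>n.
        (\<forall>t\<in>I_set n r1 r2. \<forall>x1\<in>subspaces_dim scale r1. \<forall>x2\<in>subspaces_dim scale r2.
           int (sdist scale x2 x1) = t \<longrightarrow>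
           b_coeff scale r1 r2 t = card (neighbours_at scale r2 x1 x2 (t + 1)) \<and>
           c_coeff scale r1 r2 t = card (neighbours_at scale r2 x1 x2 (t - 1))) \<and>
        (\<forall>t\<in>I_set n r1 r2.
           (t + 1 \<notin> I_set n r1 r2 \<longrightarrow> b_coeff scale r1 r2 t = 0) \<and>
           (t - 1 \<notin> I_set n r1 r2 \<longrightarrow> c_coeff scale r1 r2 t = 0)) \<and>
        (\<forall>\<Lambda> k. equivariant scale (fspace scale r1) (fspace scale r2) \<Lambda> \<and>
                has_kernel scale r1 r2 \<Lambda> k \<longrightarrow>
           has_kernel scale r1 r2 (op_laplacian scale r1 r2 \<Lambda>)
             (\<lambda>t. of_nat (b_coeff scale r1 r2 t) * (k (t + 1) - k t) +
                   of_nat (c_coeff scale r1 r2 t) * (k (t - 1) - k t)))"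
      by (intro allI impI conjI ballI; (elim conjE)?; rule coeff_eq_card coeff_eq_0 has_kernel_op_laplacian; assumption)
    show "\<forall>r1\<le>n. \<forall>r2\<le>n. \<forall>t\<in>I_set n r1 r2.
        real (b_coeff scale r1 r2 t) =
          real q powi (int r1 - int r2 + 1) * (real q powi t - real q ^ r2) *
          (real q powi t - real q powi (int n - int r1)) / (real q - 1)\<^sup>2 \<and>
        real (c_coeff scale r1 r2 t) =
          real q powi (int r1 - int r2) * (real q powi t - 1) *
          (real q powi t - real q powi (int r2 - int r1)) / (real q - 1)\<^sup>2"
      by (intro allI impI conjI ballI; rule coeff_formulas; assumption)
  qed
qed

end
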